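(* Let $(Q,N,C_1,\dots,C_N)$ be a random vector with $N\in\{0,1,2,\dots\}\cup\{\infty\}$ and $Q$, $\{C_i\}$ real valued, and let $W_n=\sum_{\mathbf{i}\in A_n}Q_{\mathbf{i}}\Pi_{\mathbf{i}}$, $n\ge0$, be constructed on the associated weighted branching tree (see context). Write $\rho_\beta=E\left[\sum_{i=1}^N|C_i|^\beta\right]$ and $\rho=\rho_1$. Let $\beta>1$ and suppose $E\left[\left(\sum_{i=1}^N|C_i|\right)^\beta\right]<\infty$, $E[|Q|^\beta]<\infty$, and $\rho\vee\rho_\beta<1$. Then there exists a constant $K_\beta>0$ such that for all $n\ge0$, $$E[|W_n|^\beta]\le K_\beta(\rho\vee\rho_\beta)^n.$$
   Context: Weighted branching tree. Let $U=\bigcup_{k=0}^\infty\{1,2,3,\dots\}^k$ be the set of finite sequences of positive integers, $\emptyset$ the empty sequence, and $(\mathbf{i},j)$ the concatenation of $\mathbf{i}\in U$ with $j$. Let $\{(Q_{\mathbf{i}},N_{\mathbf{i}},C_{(\mathbf{i},1)},\dots,C_{(\mathbf{i},N_{\mathbf{i}})})\}_{\mathbf{i}\in U}$ be iid copies of $(Q,N,C_1,\dots,C_N)$ (whose components may be arbitrarily dependent), the one at $\emptyset$ being $(Q,N,C_1,\dots,C_N)$ itself. Set $A_0=\{\emptyset\}$ and $A_n=\{(\mathbf{i},j):\mathbf{i}\in A_{n-1},\ 1\le j\le N_{\mathbf{i}}\}$ for $n\ge1$ ($j$ a finite integer), and define weights $\Pi_\emptyset=1$, $\Pi_{(\mathbf{i},j)}=C_{(\mathbf{i},j)}\Pi_{\mathbf{i}}$.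 Thus $W_0=Q$. Throughout this setting $P(Q\ne0)>0$. Sums $\sum_{i=1}^N$ run over all finite integers $1\le i\le N$; $a\vee b=\max(a,b)$. *)

theory Defs
  imports "HOL-Probability.Probability"
begin

text \<open>
  Tree nodes are lists of positive integers, and the concatenation of a node \<open>i\<close> with \<open>j\<close> is
  \<open>i @ [j]\<close>. The data of the tree are \<open>Q i\<close>, \<open>N i\<close> for every node \<open>i\<close> and the edge weight
  \<open>C (i @ [j])\<close> for every child; \<open>C []\<close> is never used. The generic vector
  \<open>(Q, N, C\<^sub>1, \<dots>, C\<^sub>N)\<close> is the one at the root: \<open>(Q [], N [], C [1], \<dots>, C [N])\<close>.
\<close>

definition nodes :: "nat list set" where
  "nodes = lists {1..}"

definition children :: "enat \<Rightarrow> nat set" where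
  "children m = {j. 1 \<le> j \<and> enat j \<le> m}"

text \<open>
  The vector \<open>(Q\<^sub>i, N\<^sub>i, C\<^sub>(\<^sub>i\<^sub>,\<^sub>1\<^sub>), \<dots>)\<close> has the random length given by \<open>N\<^sub>i\<close>. It is encoded as an element of
  a product space by padding the absent entries with 0, so that no condition whatsoever
  (measurability included) is put on \<open>C (i @ [j])\<close> where \<open>j > N i\<close>. The encoding is faithful
  because the length \<open>N i\<close> is part of the vector.
\<close>

definition mark_space :: "(real \<times> enat \<times> (nat \<Rightarrow> real)) measure" where
  "mark_space = borel \<Otimes>\<^sub>M (count_space UNIV \<Otimes>\<^sub>M (\<Pi>\<^sub>M j\<in>{1..}. borel))"

definition mark ::
  "(nat list \<Rightarrow> 'a \<Rightarrow> real) \<Rightarrow> (nat list \<Rightarrow> 'a \<Rightarrow> enat) \<Rightarrow> (nat list \<Rightarrow> 'a \<Rightarrow> real)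
    \<Rightarrow> nat list \<Rightarrow> 'a \<Rightarrow> real \<times> enat \<times> (nat \<Rightarrow> real)" where
  "mark Q N C i \<omega> =
    (Q i \<omega>, N i \<omega>, \<lambda>j\<in>{1..}. if j \<in> children (N i \<omega>) then C (i @ [j]) \<omega> else 0)"

text \<open>The vectors attached to the nodes are iid copies of the one at the root.\<close>

definition weighted_branching_tree ::
  "'a measure \<Rightarrow> (nat list \<Rightarrow> 'a \<Rightarrow> real) \<Rightarrow> (nat list \<Rightarrow> 'a \<Rightarrow> enat)
    \<Rightarrow> (nat list \<Rightarrow> 'a \<Rightarrow> real) \<Rightarrow> bool" where
  "weighted_branching_tree M Q N C \<longleftrightarrow>
    prob_space M \<and>
    prob_space.indep_vars M (\<lambda>_. mark_space) (mark Q N C) nodes \<and>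
    (\<forall>i\<in>nodes. distr M mark_space (mark Q N C i) = distr M mark_space (mark Q N C []))"

primrec generation :: "(nat list \<Rightarrow> 'a \<Rightarrow> enat) \<Rightarrow> nat \<Rightarrow> 'a \<Rightarrow> nat list set" where
  "generation N 0 \<omega> = {[]}"
| "generation N (Suc n) \<omega> = {i @ [j] | i j. i \<in> generation N n \<omega> \<and> j \<in> children (N i \<omega>)}"

fun weight :: "(nat list \<Rightarrow> 'a \<Rightarrow> real) \<Rightarrow> nat list \<Rightarrow> 'a \<Rightarrow> real" where
  "weight C i \<omega> = (if i = [] then 1 else C i \<omega> * weight C (butlast i) \<omega>)"

declare weight.simps [simp del]

lemma weight_Nil [simp]: "weight C [] \<omega> = 1"
  by (simp add: weight.simps)

lemma weight_snoc [simp]: "weight C (i @ [j]) \<omega> = C (i @ [j]) \<omega> * weight C i \<omega>"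
  by (subst weight.simps) simp

text \<open>
  A generation may be infinite; \<open>infsum\<close> on the reals is unconditional (equivalently, absolutely
  convergent) summation, with the dummy value 0 where the family is not summable.
\<close>

definition W ::
  "(nat list \<Rightarrow> 'a \<Rightarrow> real) \<Rightarrow> (nat list \<Rightarrow> 'a \<Rightarrow> enat) \<Rightarrow> (nat list \<Rightarrow> 'a \<Rightarrow> real)
    \<Rightarrow> nat \<Rightarrow> 'a \<Rightarrow> real" where
  "W Q N C n \<omega> = (\<Sum>\<^sub>\<infinity>i\<in>generation N n \<omega>. Q i \<omega> * weight C i \<omega>)"

lemma W_0: "W Q N C 0 = Q []"
  by (simp add: W_def fun_eq_iff)

text \<open>Expectations of nonnegative variables and sums of nonnegative terms are taken in \<open>[0, \<infinity>]\<close>.\<close>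

definition ennreal_powr :: "ennreal \<Rightarrow> real \<Rightarrow> ennreal" where
  "ennreal_powr x p = (if x = \<infinity> then \<infinity> else ennreal (enn2real x powr p))"
  \<comment> \<open>intended for \<open>p > 0\<close>\<close>

definition weight_sum ::
  "(nat list \<Rightarrow> 'a \<Rightarrow> enat) \<Rightarrow> (nat list \<Rightarrow> 'a \<Rightarrow> real) \<Rightarrow> real \<Rightarrow> 'a \<Rightarrow> ennreal" where
  "weight_sum N C p \<omega> = (\<Sum>\<^sub>\<infinity>j\<in>children (N [] \<omega>). ennreal (\<bar>C [j] \<omega>\<bar> powr p))"

definition \<rho> ::
  "'a measure \<Rightarrow> (nat list \<Rightarrow> 'a \<Rightarrow> enat) \<Rightarrow> (nat list \<Rightarrow> 'a \<Rightarrow> real) \<Rightarrow> real \<Rightarrow> ennreal" where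
  "\<rho> M N C p = (\<integral>\<^sup>+ \<omega>. weight_sum N C p \<omega> \<partial>M)"

end

theory Submission
  imports Defs
begin

text \<open>
  Let \<open>V\<^sub>n\<close> be the sum of \<open>|Q\<^sub>i \<Pi>\<^sub>i|\<close> over generation \<open>n\<close>, so that \<open>|W\<^sub>n| \<le> V\<^sub>n\<close>. Splitting the tree at
  its root gives \<open>V\<^sub>n\<^sub>+\<^sub>1 = (\<Sum>j. |C\<^sub>j| V\<^sub>n\<^sub>,\<^sub>j)\<close>, where the \<open>V\<^sub>n\<^sub>,\<^sub>j\<close> are independent copies of \<open>V\<^sub>n\<close>
  that are also independent of the vector at the root. For \<open>\<beta> > 1\<close>, the power \<open>\<beta>\<close> of such a sum
  exceeds the sum of the powers \<open>\<beta>\<close> only by terms that couple two different children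
  (\<open>powr_sum_le\<close>). By independence, the powers have total expectation \<open>\<rho>\<^sub>\<beta> E V\<^sub>n\<^sup>\<beta>\<close>, and each coupled
  term factors into a weight at the root times \<open>E V\<^sub>n \<cdot> E f(V\<^sub>n)\<close>, where \<open>f\<close> is any convex
  majorant of the power \<open>\<beta> - 1\<close>. Together, the weights have expectation at most
  \<open>E (\<Sum>|C\<^sub>j|)\<^sup>\<beta>\<close>, so that (\<open>moment_recursion\<close>)

    \<open>E V\<^sub>n\<^sub>+\<^sub>1\<^sup>\<beta> \<le> \<rho>\<^sub>\<beta> E V\<^sub>n\<^sup>\<beta> + const \<cdot> E V\<^sub>n \<cdot> E f(V\<^sub>n)\<close>.

  It is essential that the first coefficient is \<open>\<rho>\<^sub>\<beta>\<close> itself and not a multiple of it. Write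
  \<open>m\<close> for the maximum of \<open>\<rho>\<close> and \<open>\<rho>\<^sub>\<beta>\<close>. The mean \<open>E V\<^sub>n\<close> is of order \<open>\<rho>\<^sup>n\<close>; if \<open>E f(V\<^sub>n)\<close> decays
  geometrically at any rate \<open>r < 1\<close>, then the inhomogeneous term is of order \<open>m\<^sup>n r\<^sup>n\<close>, which is summable
  against \<open>m\<^sup>n\<close>, and the rate \<open>m\<^sup>n\<close> follows (\<open>geometric_recursion_bound\<close>).

  The decay of \<open>E f(V\<^sub>n)\<close> comes from a smaller exponent. If \<open>\<beta> - 1 \<ge> 1\<close>, take for \<open>f\<close> the power
  \<open>\<beta> - 1\<close> itself and argue by induction on an integer bound for the
  exponent; this uses that \<open>\<rho>\<^sub>p \<le> m\<close> for every \<open>p\<close> between 1 and \<open>\<beta>\<close>, which holds because \<open>x\<^sup>p\<close> is at most a convex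
  combination of \<open>x\<close> and \<open>x\<^sup>\<beta>\<close>. If \<open>\<beta> - 1 < 1\<close>, the power is concave, and an affine majorant
  adapted to the scale \<open>m\<^sup>n\<close> reduces \<open>E f(V\<^sub>n)\<close> to the mean.

  Two devices keep the measure theory light. The marks of the tree are transported to the product
  space over the nodes, on which a subtree is a reindexing that preserves the product
  measure. And the recursion is run for trees in which only the children \<open>1, \<dots>, k\<close> of each node are
  kept: all sums are then finite, the bounds do not depend on \<open>k\<close>, and
  monotone convergence removes the truncation. The almost sure finiteness of the limit gives the
  summability of the series that defines \<open>W\<^sub>n\<close>.
\<close>

section \<open>Inequalities for powers of sums\<close>

text \<open>
  The point is the coefficient 1 of \<open>x powr \<gamma>\<close>. For \<open>\<gamma> < 1\<close> the power is subadditive; for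
  \<open>\<gamma> \<ge> 1\<close> the correction that is linear in \<open>s\<close> comes from the mean value theorem when \<open>s \<le> x\<close>, and
  otherwise the left-hand side is at most a multiple of \<open>s powr \<gamma>\<close>.
\<close>

lemma powr_increment:
  fixes \<gamma> :: real
  assumes "\<gamma> > 0"
  obtains K where "K > 0"
    "\<And>x s. x \<ge> 0 \<Longrightarrow> s \<ge> 0 \<Longrightarrow>
       (x + s) powr \<gamma> \<le> x powr \<gamma> + K * (s powr \<gamma> + (if \<gamma> \<ge> 1 then x powr (\<gamma> - 1) * s else 0))"
proof (cases "\<gamma> \<ge> 1")
  case True
  define K where "K = \<gamma> * 2 powr \<gamma>"
  have K: "K > 0" "2 powr \<gamma> \<le> K" using True by (auto simp: K_def)
  have "(x + s) powr \<gamma> \<le> x powr \<gamma> + K * (s powr \<gamma> + x powr (\<gamma> - 1) * s)"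
    if x: "x \<ge> 0" and s: "s \<ge> 0" for x s :: real
  proof -
    consider "x < s" | "s = 0" | "0 < s" "s \<le> x" using s by linarith
    then show ?thesis
    proof cases
      case 1
      have "(x + s) powr \<gamma> \<le> (2 * s) powr \<gamma>" using 1 x True by (intro powr_mono2) auto
      also have "\<dots> = 2 powr \<gamma> * s powr \<gamma>" by (simp add: powr_mult)
      also have "\<dots> \<le> K * s powr \<gamma>" using K by (intro mult_right_mono) auto
      also have "\<dots> \<le> x powr \<gamma> + K * (s powr \<gamma> + x powr (\<gamma> - 1) * s)"
        using K s by (simp add: distrib_left)
      finally show ?thesis .
    next
      case 2
      then show ?thesis using K by simp
    next
      case 3
      have "\<exists>z. x < z \<and> z < x + s \<and>
          (x + s) powr \<gamma> - x powr \<gamma> = (x + s - x) * (\<gamma> * z powr (\<gamma> - 1))"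
        using 3 by (intro MVT2) (auto intro!: derivative_eq_intros)
      then obtain z where z: "x < z" "z < x + s"
        "(x + s) powr \<gamma> - x powr \<gamma> = (x + s - x) * (\<gamma> * z powr (\<gamma> - 1))" by blast
      have "z powr (\<gamma> - 1) \<le> (2 * x) powr (\<gamma> - 1)"
        using z 3 True by (intro powr_mono2) auto
      also have "\<dots> = 2 powr (\<gamma> - 1) * x powr (\<gamma> - 1)" by (simp add: powr_mult)
      also have "\<dots> \<le> 2 powr \<gamma> * x powr (\<gamma> - 1)" by (intro mult_right_mono powr_mono) auto
      finally have "s * (\<gamma> * z powr (\<gamma> - 1)) \<le> s * (\<gamma> * (2 powr \<gamma> * x powr (\<gamma> - 1)))"
        using 3 True by (intro mult_left_mono) auto
      also have "\<dots> = K * (x powr (\<gamma> - 1) * s)" by (simp add: K_def)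
      finally have "(x + s) powr \<gamma> \<le> x powr \<gamma> + K * (x powr (\<gamma> - 1) * s)" using z(3) by simp
      also have "\<dots> \<le> x powr \<gamma> + K * (s powr \<gamma> + x powr (\<gamma> - 1) * s)"
        using K by (simp add: distrib_left)
      finally show ?thesis .
    qed
  qed
  then show ?thesis using True K by (intro that[of K]) auto
next
  case False
  have "(x + s) powr \<gamma> \<le> x powr \<gamma> + s powr \<gamma>" if x: "x \<ge> 0" and s: "s \<ge> 0" for x s :: real
  proof (cases "x + s = 0")
    case True
    then show ?thesis by simp
  next
    case nz: False
    define t where "t = x + s"
    have t: "t > 0" using nz x s by (simp add: t_def)
    have frac: "v / t \<le> (v / t) powr \<gamma>" if "0 \<le> v" "v \<le> t" for v
      using that t False powr_mono'[of \<gamma> 1 "v / t"] by (simp add: divide_le_eq)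
    have "1 = x / t + s / t" using t by (simp add: t_def flip: add_divide_distrib)
    also have "\<dots> \<le> (x / t) powr \<gamma> + (s / t) powr \<gamma>"
      using x s by (intro add_mono frac) (auto simp: t_def)
    also have "\<dots> = (x powr \<gamma> + s powr \<gamma>) / t powr \<gamma>"
      using x s t by (simp add: powr_divide add_divide_distrib)
    finally show ?thesis using t by (simp add: t_def[symmetric] le_divide_eq split: if_splits)
  qed
  then show ?thesis using False by (intro that[of 1]) auto
qed

lemma convex_on_powr_nonneg:
  fixes p :: real
  assumes "p \<ge> 1"
  shows "convex_on {0..} (\<lambda>x. x powr p)"
proof (rule convex_onI)
  fix t x y :: real
  assume t: "0 < t" "t < 1" and xy: "x \<in> {0..}" "y \<in> {0..}"
  have scale: "(u * v) powr p \<le> u * v powr p" if "0 < u" "u < 1" "0 \<le> v" for u v :: real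
    using that assms powr_mono'[of 1 p u] by (simp add: powr_mult mult_right_mono)
  show "((1 - t) *\<^sub>R x + t *\<^sub>R y) powr p \<le> (1 - t) * x powr p + t * y powr p"
  proof (cases "x = 0 \<or> y = 0")
    case True
    then show ?thesis using scale[of t y] scale[of "1 - t" x] t xy assms by auto
  next
    case False
    then show ?thesis
      using t xy convex_onD[OF powr_convex[OF assms], of t x y] by simp
  qed
qed auto

text \<open>
  Jensen's inequality for the weights \<open>c j\<close> normalised by their sum. A general convex majorant
  \<open>f\<close> of the power covers both \<open>\<gamma> \<ge> 1\<close>, where \<open>f\<close> can be the power itself, and \<open>\<gamma> < 1\<close>, where \<open>f\<close> can be
  affine. If all weights vanish, both sides are 0.
\<close>

lemma weighted_sum_powr_le:
  fixes c y :: "'i \<Rightarrow> real" and f :: "real \<Rightarrow> real"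
  assumes f: "convex_on {0..} f" "\<And>u. u \<ge> 0 \<Longrightarrow> u powr \<gamma> \<le> f u"
    and J: "finite J" "\<And>j. j \<in> J \<Longrightarrow> c j \<ge> 0" "\<And>j. j \<in> J \<Longrightarrow> y j \<ge> 0"
  shows "(\<Sum>j\<in>J. c j * y j) powr \<gamma> \<le> (\<Sum>j\<in>J. c j) powr (\<gamma> - 1) * (\<Sum>j\<in>J. c j * f (y j))"
proof (cases "(\<Sum>j\<in>J. c j) = 0")
  case True
  then have "c j = 0" if "j \<in> J" for j using that J by (simp add: sum_nonneg_eq_0_iff)
  then show ?thesis by simp
next
  case False
  define T where "T = (\<Sum>j\<in>J. c j)"
  have T: "T > 0" using False J sum_nonneg[of J c] by (simp add: T_def)
  have mean: "(\<Sum>j\<in>J. c j * g j) / T = (\<Sum>j\<in>J. (c j / T) * g j)" for g :: "'i \<Rightarrow> real"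
    by (simp add: sum_divide_distrib)
  have "((\<Sum>j\<in>J. c j * y j) / T) powr \<gamma> \<le> f ((\<Sum>j\<in>J. c j * y j) / T)"
    using J T by (intro f(2) divide_nonneg_pos sum_nonneg) auto
  also have "\<dots> = f (\<Sum>j\<in>J. (c j / T) *\<^sub>R y j)" by (simp add: mean)
  also have "\<dots> \<le> (\<Sum>j\<in>J. (c j / T) * f (y j))"
    using J T False by (intro convex_on_sum[OF _ _ f(1)]) (auto simp: T_def simp flip: sum_divide_distrib)
  also have "\<dots> = (\<Sum>j\<in>J. c j * f (y j)) / T" by (simp add: mean)
  finally have "((\<Sum>j\<in>J. c j * y j) / T) powr \<gamma> * T powr \<gamma> \<le> (\<Sum>j\<in>J. c j * f (y j)) / T * T powr \<gamma>"
    by (intro mult_right_mono) auto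
  then show ?thesis using T J unfolding T_def[symmetric]
    by (simp add: powr_divide sum_nonneg powr_diff mult.commute)
qed

text \<open>
  Write \<open>S = (\<Sum>i. x i)\<close> with \<open>x i = c i * y i\<close>, expand \<open>S powr (\<gamma> + 1) = (\<Sum>i. x i * S powr \<gamma>)\<close> and
  apply \<open>powr_increment\<close> to \<open>S = x i + R i\<close>, with \<open>R i\<close> the sum of the other terms. The leading
  part yields the diagonal powers. In the remainder, Jensen's inequality turns \<open>R i powr \<gamma>\<close> into a
  sum over \<open>j \<noteq> i\<close> in which \<open>y i\<close> and \<open>y j\<close> are separated. The constant depends on \<open>\<gamma>\<close> only.
\<close>

lemma powr_sum_le:
  fixes \<gamma> :: real
  assumes \<gamma>: "\<gamma> > 0"
  obtains K where "K > 0"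
    "\<And>(I :: 'i set) c y f.
       \<lbrakk>finite I; \<And>i. i \<in> I \<Longrightarrow> c i \<ge> 0; \<And>i. i \<in> I \<Longrightarrow> y i \<ge> 0;
        convex_on {0..} f; \<And>u. u \<ge> 0 \<Longrightarrow> u powr \<gamma> \<le> f u\<rbrakk> \<Longrightarrow>
       (\<Sum>i\<in>I. c i * y i) powr (\<gamma> + 1)
         \<le> (\<Sum>i\<in>I. c i powr (\<gamma> + 1) * y i powr (\<gamma> + 1))
           + K * (\<Sum>i\<in>I. \<Sum>j\<in>I - {i}. c i * c j * (\<Sum>l\<in>I - {i}. c l) powr (\<gamma> - 1) * (y i * f (y j)))"
proof -
  obtain K where K: "K > 0"
    "\<And>x s. x \<ge> 0 \<Longrightarrow> s \<ge> 0 \<Longrightarrow>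
       (x + s) powr \<gamma> \<le> x powr \<gamma> + K * (s powr \<gamma> + (if \<gamma> \<ge> 1 then x powr (\<gamma> - 1) * s else 0))"
    using powr_increment[OF \<gamma>] by blast
  show thesis
  proof (rule that[of "2 * K"])
    fix I :: "'i set" and c y f
    assume I: "finite I" and c: "\<And>i. i \<in> I \<Longrightarrow> c i \<ge> (0::real)" and y: "\<And>i. i \<in> I \<Longrightarrow> y i \<ge> (0::real)"
      and f: "convex_on {0..} f" "\<And>u. u \<ge> 0 \<Longrightarrow> u powr \<gamma> \<le> f u"
    define x where "x i = c i * y i" for i
    define S where "S = (\<Sum>i\<in>I. x i)"
    define R where "R i = (\<Sum>j\<in>I - {i}. x j)" for i
    define T where "T i = (\<Sum>j\<in>I - {i}. c j)" for i
    define D where "D = (\<Sum>i\<in>I. \<Sum>j\<in>I - {i}. c i * c j * T i powr (\<gamma> - 1) * (y i * f (y j)))"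
    have x0: "x i \<ge> 0" if "i \<in> I" for i using that c y by (simp add: x_def)
    have R0: "R i \<ge> 0" if "i \<in> I" for i using that x0 by (auto simp: R_def intro!: sum_nonneg)
    have S: "S = x i + R i" if "i \<in> I" for i using that I by (simp add: S_def R_def sum.remove)
    have S0: "S \<ge> 0" using x0 by (auto simp: S_def intro: sum_nonneg)
    have mult_powr: "x i * x i powr \<gamma> = c i powr (\<gamma> + 1) * y i powr (\<gamma> + 1)" if "i \<in> I" for i
      using x0[OF that] c[OF that] y[OF that] by (simp add: x_def powr_mult powr_add)
    have far: "x i * R i powr \<gamma> \<le> (\<Sum>j\<in>I - {i}. c i * c j * T i powr (\<gamma> - 1) * (y i * f (y j)))"
      if "i \<in> I" for i
    proof -
      have "R i powr \<gamma> \<le> T i powr (\<gamma> - 1) * (\<Sum>j\<in>I - {i}. c j * f (y j))"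
        unfolding R_def T_def x_def using I c y by (intro weighted_sum_powr_le f) auto
      then have "x i * R i powr \<gamma> \<le> x i * (T i powr (\<gamma> - 1) * (\<Sum>j\<in>I - {i}. c j * f (y j)))"
        using x0[OF that] by (intro mult_left_mono)
      then show ?thesis by (simp add: sum_distrib_left x_def mult_ac)
    qed
    have sum_far: "(\<Sum>i\<in>I. x i * R i powr \<gamma>) \<le> D"
      unfolding D_def by (intro sum_mono far)
    (* Interchanging the two sums puts the power \<gamma> on the inner index, where D has f. *)
    have near: "(\<Sum>i\<in>I. x i * (if \<gamma> \<ge> 1 then x i powr (\<gamma> - 1) * R i else 0)) \<le> D"
    proof (cases "\<gamma> \<ge> 1")
      case True
      have "(\<Sum>i\<in>I. x i * (x i powr (\<gamma> - 1) * R i)) = (\<Sum>i\<in>I. \<Sum>j\<in>I - {i}. x j * x i powr \<gamma>)"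
      proof (rule sum.cong[OF refl])
        fix i assume i: "i \<in> I"
        show "x i * (x i powr (\<gamma> - 1) * R i) = (\<Sum>j\<in>I - {i}. x j * x i powr \<gamma>)"
          using x0[OF i] by (cases "x i = 0") (auto simp: R_def powr_diff mult.commute simp flip: sum_distrib_right)
      qed
      also have "\<dots> = (\<Sum>i\<in>I. \<Sum>j\<in>I. if j \<noteq> i then x j * x i powr \<gamma> else 0)"
        using I by (intro sum.cong refl sum.mono_neutral_cong_left) auto
      also have "\<dots> = (\<Sum>j\<in>I. \<Sum>i\<in>I. if j \<noteq> i then x j * x i powr \<gamma> else 0)" by (rule sum.swap)
      also have "\<dots> = (\<Sum>j\<in>I. \<Sum>i\<in>I - {j}. x j * x i powr \<gamma>)"
        using I by (intro sum.cong refl sum.mono_neutral_cong_right) auto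
      also have "\<dots> \<le> D" unfolding D_def
      proof (intro sum_mono)
        fix j i assume ij: "j \<in> I" "i \<in> I - {j}"
        have ci: "c i powr \<gamma> \<le> c i * T j powr (\<gamma> - 1)"
        proof (cases "c i = 0")
          case False
          have "c i \<le> T j" unfolding T_def using ij c I by (intro member_le_sum) auto
          then have "c i * c i powr (\<gamma> - 1) \<le> c i * T j powr (\<gamma> - 1)"
            using True ij c by (intro mult_left_mono powr_mono2) auto
          then show ?thesis using False c[of i] ij by (simp add: powr_diff)
        qed (use \<gamma> in simp)
        have "x j * x i powr \<gamma> = x j * (c i powr \<gamma> * y i powr \<gamma>)"
          using c y ij by (simp add: x_def powr_mult)
        also have "\<dots> \<le> x j * ((c i * T j powr (\<gamma> - 1)) * f (y i))"
          using ci f(2)[of "y i"] x0 y c ij by (intro mult_left_mono mult_mono) auto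
        finally show "x j * x i powr \<gamma> \<le> c j * c i * T j powr (\<gamma> - 1) * (y j * f (y i))"
          by (simp add: x_def mult_ac)
      qed
      finally show ?thesis using True by simp
    next
      case False
      have "0 \<le> D" unfolding D_def
        using c y order_trans[OF powr_ge_zero f(2)]
        by (intro sum_nonneg mult_nonneg_nonneg) auto
      then show ?thesis using False by simp
    qed
    have "S powr (\<gamma> + 1) = (\<Sum>i\<in>I. x i * S powr \<gamma>)"
      using S0 by (simp add: powr_add S_def mult.commute flip: sum_distrib_right)
    also have "\<dots> \<le> (\<Sum>i\<in>I. x i * (x i powr \<gamma> + K * (R i powr \<gamma> +
                     (if \<gamma> \<ge> 1 then x i powr (\<gamma> - 1) * R i else 0))))"
      using K(2) x0 R0 by (intro sum_mono mult_left_mono) (auto simp: S)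
    also have "\<dots> = (\<Sum>i\<in>I. x i * x i powr \<gamma>) + K * ((\<Sum>i\<in>I. x i * R i powr \<gamma>) +
                     (\<Sum>i\<in>I. x i * (if \<gamma> \<ge> 1 then x i powr (\<gamma> - 1) * R i else 0)))"
      by (simp add: sum_distrib_left sum.distrib[symmetric] algebra_simps)
    also have "\<dots> \<le> (\<Sum>i\<in>I. x i * x i powr \<gamma>) + K * (D + D)"
      using K(1) near sum_far by (intro add_left_mono mult_left_mono add_mono) auto
    also have "(\<Sum>i\<in>I. x i * x i powr \<gamma>) = (\<Sum>i\<in>I. c i powr (\<gamma> + 1) * y i powr (\<gamma> + 1))"
      using mult_powr by (intro sum.cong) auto
    finally show "(\<Sum>i\<in>I. c i * y i) powr (\<gamma> + 1)
         \<le> (\<Sum>i\<in>I. c i powr (\<gamma> + 1) * y i powr (\<gamma> + 1))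
           + 2 * K * (\<Sum>i\<in>I. \<Sum>j\<in>I - {i}. c i * c j * (\<Sum>l\<in>I - {i}. c l) powr (\<gamma> - 1) * (y i * f (y j)))"
      by (simp add: S_def x_def D_def T_def)
  qed (use K in auto)
qed

text \<open>
  For fixed \<open>i\<close> the weights add up to \<open>c i\<close> times the power \<open>\<gamma>\<close> of the sum of the others.
\<close>

lemma sum_pair_weights_le:
  fixes c :: "'i \<Rightarrow> real"
  assumes "\<gamma> > 0" "finite I" and c: "\<And>i. i \<in> I \<Longrightarrow> c i \<ge> 0"
  shows "(\<Sum>i\<in>I. \<Sum>j\<in>I - {i}. c i * c j * (\<Sum>l\<in>I - {i}. c l) powr (\<gamma> - 1)) \<le> (\<Sum>i\<in>I. c i) powr (\<gamma> + 1)"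
proof -
  define S where "S = (\<Sum>i\<in>I. c i)"
  have S0: "S \<ge> 0" unfolding S_def using c by (rule sum_nonneg)
  have "(\<Sum>j\<in>I - {i}. c i * c j * (\<Sum>l\<in>I - {i}. c l) powr (\<gamma> - 1)) \<le> c i * S powr \<gamma>" if i: "i \<in> I" for i
  proof -
    define T where "T = (\<Sum>l\<in>I - {i}. c l)"
    have T: "0 \<le> T" "T \<le> S" unfolding T_def S_def using assms by (auto intro!: sum_nonneg sum_mono2)
    have "(\<Sum>j\<in>I - {i}. c i * c j * T powr (\<gamma> - 1)) = c i * (T * T powr (\<gamma> - 1))"
      by (simp add: T_def sum_distrib_left sum_distrib_right mult_ac)
    also have "T * T powr (\<gamma> - 1) = T powr \<gamma>" using T by (cases "T = 0") (auto simp: powr_diff)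
    also have "c i * T powr \<gamma> \<le> c i * S powr \<gamma>"
      using T assms i by (intro mult_left_mono powr_mono2) auto
    finally show ?thesis by (simp add: T_def)
  qed
  then have "(\<Sum>i\<in>I. \<Sum>j\<in>I - {i}. c i * c j * (\<Sum>l\<in>I - {i}. c l) powr (\<gamma> - 1)) \<le> (\<Sum>i\<in>I. c i * S powr \<gamma>)"
    by (rule sum_mono)
  also have "\<dots> = S powr (\<gamma> + 1)" using S0 by (simp add: S_def powr_add mult.commute flip: sum_distrib_right)
  finally show ?thesis by (simp add: S_def)
qed

text \<open>
  Convexity of the exponential function, as \<open>x powr p\<close> is log-linear in \<open>p\<close>.
\<close>

lemma powr_interpolation:
  fixes p b :: real
  assumes "1 \<le> p" "p \<le> b"
  obtains t where "0 \<le> t" "t \<le> 1" "\<And>x. x \<ge> 0 \<Longrightarrow> x powr p \<le> (1 - t) * x powr 1 + t * x powr b"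
proof -
  define t where "t = (if b = 1 then 0 else (p - 1) / (b - 1))"
  have t: "0 \<le> t" "t \<le> 1" "p = (1 - t) * 1 + t * b" using assms by (auto simp: t_def field_simps)
  have "x powr p \<le> (1 - t) * x powr 1 + t * x powr b" if "x \<ge> 0" for x
  proof (cases "x = 0")
    case False
    with that show ?thesis
      using convex_onD[OF exp_convex t(1,2), of "1 * ln x" "b * ln x"]
      by (simp add: powr_def t(3) algebra_simps)
  qed (use assms in simp)
  then show thesis using t that by blast
qed

lemma powr_le_one_add_powr:
  fixes x p b :: real
  assumes "0 \<le> x" "0 \<le> p" "p \<le> b"
  shows "x powr p \<le> 1 + x powr b"
proof (cases "x \<le> 1")
  case True
  then show ?thesis using powr_mono2[of p x 1] assms by (simp add: add.commute add_increasing2)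
next
  case False
  then have "x powr p \<le> x powr b" using assms by (intro powr_mono) auto
  then show ?thesis by simp
qed

text \<open>
  Up to constants this is the tangent of the concave power at \<open>s\<close>.
\<close>

lemma powr_le_affine:
  fixes \<gamma> s u :: real
  assumes "0 < \<gamma>" "\<gamma> \<le> 1" "0 < s" "0 \<le> u"
  shows "u powr \<gamma> \<le> s powr \<gamma> + s powr (\<gamma> - 1) * u"
proof (cases "u \<le> s")
  case True
  then have "u powr \<gamma> \<le> s powr \<gamma>" using assms by (intro powr_mono2) auto
  then show ?thesis using assms by (simp add: add_increasing2)
next
  case False
  then have "u powr (\<gamma> - 1) \<le> s powr (\<gamma> - 1)" using assms by (intro powr_mono2') auto
  then have "u powr (\<gamma> - 1) * u \<le> s powr (\<gamma> - 1) * u" using assms by (intro mult_right_mono)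
  moreover have "u powr (\<gamma> - 1) * u = u powr \<gamma>" using False assms by (simp add: powr_diff)
  ultimately show ?thesis by (simp add: add_increasing)
qed

section \<open>The product space of marks and its subtrees\<close>

lemma Nil_in_nodes [simp]: "[] \<in> nodes"
  by (simp add: nodes_def)

lemma Cons_in_nodes [simp]: "j # i \<in> nodes \<longleftrightarrow> 1 \<le> j \<and> i \<in> nodes"
  by (auto simp: nodes_def)

definition subtree :: "nat \<Rightarrow> (nat list \<Rightarrow> 'x) \<Rightarrow> nat list \<Rightarrow> 'x" where
  "subtree j x = (\<lambda>i\<in>nodes. x (j # i))"

text \<open>
  Only nonnegative functions of the mark at a node matter for the sums of absolute values: \<open>q\<close>
  for \<open>|Q|\<close>, and \<open>c j\<close> for the absolute weight of the edge to child \<open>j\<close>, which is 0 if that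
  child is absent. With this convention every node has all the children \<open>1, 2, \<dots>\<close>.
\<close>

locale iid_tree = prob_space \<mu> for \<mu> :: "'x measure" +
  fixes q :: "'x \<Rightarrow> real" and c :: "nat \<Rightarrow> 'x \<Rightarrow> real"
  assumes q_measurable [measurable]: "q \<in> borel_measurable \<mu>"
    and c_measurable [measurable]: "\<And>j. c j \<in> borel_measurable \<mu>"
    and q_nonneg: "\<And>x. q x \<ge> 0"
    and c_nonneg: "\<And>j x. c j x \<ge> 0"
begin

definition tree :: "(nat list \<Rightarrow> 'x) measure" where
  "tree = PiM nodes (\<lambda>_. \<mu>)"

sublocale T: prob_space tree
  unfolding tree_def by (intro prob_space_PiM prob_space_axioms)

lemma node_measurable: "i \<in> nodes \<Longrightarrow> (\<lambda>x. x i) \<in> measurable tree \<mu>"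
  by (simp add: tree_def)

lemma root_measurable [measurable]: "(\<lambda>x. x []) \<in> measurable tree \<mu>"
  by (simp add: node_measurable)

lemma subtree_measurable: "1 \<le> j \<Longrightarrow> subtree j \<in> measurable tree tree"
  unfolding tree_def subtree_def by (intro measurable_restrict measurable_component_singleton) simp

lemma distr_subtree:
  assumes "1 \<le> j"
  shows "distr tree tree (subtree j) = tree"
  using distr_PiM_reindex[of nodes "\<lambda>_. \<mu>" "(#) j" nodes] assms prob_space_axioms
  by (auto simp: tree_def subtree_def[abs_def] inj_on_def)

lemma nn_integral_subtree:
  assumes "1 \<le> j" "f \<in> borel_measurable tree"
  shows "(\<integral>\<^sup>+x. f (subtree j x) \<partial>tree) = (\<integral>\<^sup>+x. f x \<partial>tree)"
  using nn_integral_distr[OF subtree_measurable[OF assms(1)], of f] assms by (simp add: distr_subtree)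

lemma nn_integral_root:
  assumes "g \<in> borel_measurable \<mu>"
  shows "(\<integral>\<^sup>+x. g (x []) \<partial>tree) = (\<integral>\<^sup>+v. g v \<partial>\<mu>)"
proof -
  have "distr tree \<mu> (\<lambda>x. x []) = \<mu>"
    unfolding tree_def using prob_space_axioms by (intro distr_PiM_component) auto
  then show ?thesis using nn_integral_distr[OF root_measurable, of g] assms by simp
qed

lemma indep_nodes: "T.indep_vars (\<lambda>_. \<mu>) (\<lambda>i x. x i) nodes"
proof -
  have "distr tree (PiM nodes (\<lambda>_. \<mu>)) (\<lambda>x. \<lambda>i\<in>nodes. x i) = distr tree tree (\<lambda>x. x)"
    unfolding tree_def by (intro distr_cong refl) (auto simp: space_PiM PiE_restrict)
  also have "\<dots> = PiM nodes (\<lambda>i. distr tree \<mu> (\<lambda>x. x i))"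
    using prob_space_axioms distr_PiM_component[of nodes "\<lambda>_. \<mu>"]
    by (simp add: tree_def distr_id cong: PiM_cong)
  finally have law: "distr tree (PiM nodes (\<lambda>_. \<mu>)) (\<lambda>x. \<lambda>i\<in>nodes. x i)
    = PiM nodes (\<lambda>i. distr tree \<mu> (\<lambda>x. x i))" .
  have "nodes \<noteq> {}" using Nil_in_nodes by blast
  then show ?thesis using node_measurable law by (subst T.indep_vars_iff_distr_eq_PiM') auto
qed

text \<open>
  The root and the subtrees of distinct children depend on disjoint sets of coordinates of the
  product space, and each subtree again has the law of the whole tree.
\<close>

lemma branching_property:
  fixes f :: "nat \<Rightarrow> (nat list \<Rightarrow> 'x) \<Rightarrow> ennreal"
  assumes J: "finite J" "J \<subseteq> {1..}"
    and g: "g \<in> borel_measurable \<mu>" and f: "\<And>j. j \<in> J \<Longrightarrow> f j \<in> borel_measurable tree"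
  shows "(\<integral>\<^sup>+x. g (x []) * (\<Prod>j\<in>J. f j (subtree j x)) \<partial>tree)
       = (\<integral>\<^sup>+v. g v \<partial>\<mu>) * (\<Prod>j\<in>J. \<integral>\<^sup>+x. f j x \<partial>tree)"
proof -
  (* The index 0 is not a child, so it can stand for the root. *)
  define K where "K l = (if l = 0 then {[]} else (#) l ` nodes)" for l :: nat
  define Y where "Y l z = (if l = 0 then g (z []) else f l (\<lambda>i\<in>nodes. z (l # i)))"
    for l :: nat and z :: "nat list \<Rightarrow> 'x"
  have J0: "0 \<notin> J" using J by auto
  have K: "K l \<subseteq> nodes" if "l \<in> insert 0 J" for l
    using that J by (auto simp: K_def)
  have "T.indep_vars (\<lambda>_. \<mu>) (\<lambda>i x. x i) nodes"
    by (rule indep_nodes)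
  then have "T.indep_vars (\<lambda>l. PiM (K l) (\<lambda>_. \<mu>)) (\<lambda>l x. restrict x (K l)) (insert 0 J)"
    using K by (rule T.indep_vars_restrict) (auto simp: K_def disjoint_family_on_def)
  moreover have "Y l \<in> borel_measurable (PiM (K l) (\<lambda>_. \<mu>))" if "l \<in> insert 0 J" for l
  proof (cases "l = 0")
    case True
    have "(\<lambda>z. z []) \<in> measurable (PiM (K l) (\<lambda>_. \<mu>)) \<mu>"
      using True by (intro measurable_component_singleton) (simp add: K_def)
    then have "(\<lambda>z. g (z [])) \<in> borel_measurable (PiM (K l) (\<lambda>_. \<mu>))" using g by (rule measurable_compose)
    then show ?thesis using True by (simp add: Y_def[abs_def])
  next
    case False
    then have "(\<lambda>z. \<lambda>i\<in>nodes. z (l # i)) \<in> measurable (PiM (K l) (\<lambda>_. \<mu>)) tree"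
      unfolding tree_def by (intro measurable_restrict measurable_component_singleton) (simp add: K_def)
    from measurable_compose[OF this, of "f l" borel]
    have "(\<lambda>z. f l (\<lambda>i\<in>nodes. z (l # i))) \<in> borel_measurable (PiM (K l) (\<lambda>_. \<mu>))"
      using f that False by simp
    then show ?thesis using False by (simp add: Y_def[abs_def])
  qed
  ultimately have "T.indep_vars (\<lambda>_. borel) (\<lambda>l x. Y l (restrict x (K l))) (insert 0 J)"
    using T.indep_vars_compose2[where Y = Y and N = "\<lambda>_. borel" and X = "\<lambda>l x. restrict x (K l)"] by blast
  then have "(\<integral>\<^sup>+x. (\<Prod>l\<in>insert 0 J. Y l (restrict x (K l))) \<partial>tree)
           = (\<Prod>l\<in>insert 0 J. \<integral>\<^sup>+x. Y l (restrict x (K l)) \<partial>tree)"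
    using J by (intro T.indep_vars_nn_integral) auto
  moreover have "Y 0 (restrict x (K 0)) = g (x [])" for x by (simp add: Y_def K_def)
  moreover have "Y j (restrict x (K j)) = f j (subtree j x)" if "j \<in> J" for j x
  proof -
    have "(\<lambda>i\<in>nodes. restrict x (K j) (j # i)) = subtree j x"
      using that J0 by (auto simp: K_def subtree_def fun_eq_iff restrict_def)
    then show ?thesis using that J0 by (auto simp: Y_def)
  qed
  ultimately have "(\<integral>\<^sup>+x. g (x []) * (\<Prod>j\<in>J. f j (subtree j x)) \<partial>tree)
       = (\<integral>\<^sup>+x. g (x []) \<partial>tree) * (\<Prod>j\<in>J. \<integral>\<^sup>+x. f j (subtree j x) \<partial>tree)"
    using J J0 by simp
  also have "\<dots> = (\<integral>\<^sup>+v. g v \<partial>\<mu>) * (\<Prod>j\<in>J. \<integral>\<^sup>+x. f j x \<partial>tree)"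
    using J f g by (intro arg_cong2[of _ _ _ _ "(*)"] prod.cong refl nn_integral_root nn_integral_subtree) auto
  finally show ?thesis .
qed

text \<open>
  The sum of \<open>|Q\<^sub>i \<Pi>\<^sub>i|\<close> over generation \<open>n\<close> of the tree in which every node keeps its first \<open>k\<close> children only,
  defined by splitting off the first generation. The explicit form is \<open>V_eq_sum_paths\<close>.
\<close>

primrec V :: "nat \<Rightarrow> nat \<Rightarrow> (nat list \<Rightarrow> 'x) \<Rightarrow> real" where
  "V k 0 x = q (x [])"
| "V k (Suc n) x = (\<Sum>j\<in>{1..k}. c j (x []) * V k n (subtree j x))"

lemma V_nonneg: "V k n x \<ge> 0"
  by (induction n arbitrary: x) (auto intro!: sum_nonneg mult_nonneg_nonneg q_nonneg c_nonneg)

lemma V_measurable [measurable]: "V k n \<in> borel_measurable tree"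
proof (induction n)
  case (Suc n)
  have "(\<lambda>x. c j (x []) * V k n (subtree j x)) \<in> borel_measurable tree" if "j \<in> {1..k}" for j
    using that by (intro borel_measurable_times measurable_compose[OF subtree_measurable Suc]) auto
  then show ?case by (simp add: borel_measurable_sum cong: measurable_cong)
qed simp

abbreviation moment :: "real \<Rightarrow> nat \<Rightarrow> nat \<Rightarrow> ennreal" where
  "moment p k n \<equiv> \<integral>\<^sup>+x. ennreal (V k n x powr p) \<partial>tree"

abbreviation rho_upto :: "real \<Rightarrow> nat \<Rightarrow> ennreal" where
  "rho_upto p k \<equiv> \<integral>\<^sup>+v. ennreal (\<Sum>j\<in>{1..k}. c j v powr p) \<partial>\<mu>"

lemma nn_integral_child:
  assumes j: "1 \<le> j" and g: "g \<in> borel_measurable \<mu>" and f: "f \<in> borel_measurable tree"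
    and nonneg: "\<And>v. g v \<ge> 0"
  shows "(\<integral>\<^sup>+x. ennreal (g (x []) * f (subtree j x)) \<partial>tree)
       = (\<integral>\<^sup>+v. ennreal (g v) \<partial>\<mu>) * (\<integral>\<^sup>+x. ennreal (f x) \<partial>tree)"
  using branching_property[of "{j}" "\<lambda>v. ennreal (g v)" "\<lambda>_ x. ennreal (f x)"] assms
  by (simp add: ennreal_mult')

lemma nn_integral_two_children:
  assumes ij: "1 \<le> i" "1 \<le> j" "i \<noteq> j" and g: "g \<in> borel_measurable \<mu>"
    and f: "f \<in> borel_measurable tree" and h: "h \<in> borel_measurable tree"
    and nonneg: "\<And>v. g v \<ge> 0" "\<And>x. f x \<ge> 0"
  shows "(\<integral>\<^sup>+x. ennreal (g (x []) * (f (subtree i x) * h (subtree j x))) \<partial>tree)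
       = (\<integral>\<^sup>+v. ennreal (g v) \<partial>\<mu>) * ((\<integral>\<^sup>+x. ennreal (f x) \<partial>tree) * (\<integral>\<^sup>+x. ennreal (h x) \<partial>tree))"
  using branching_property[of "{i, j}" "\<lambda>v. ennreal (g v)" "\<lambda>l x. ennreal (if l = i then f x else h x)"] assms
  by (simp add: ennreal_mult')

lemma mean_Suc: "moment 1 k (Suc n) = rho_upto 1 k * moment 1 k n"
proof -
  have "moment 1 k (Suc n) = (\<integral>\<^sup>+x. (\<Sum>j\<in>{1..k}. ennreal (c j (x []) * V k n (subtree j x))) \<partial>tree)"
  proof (rule nn_integral_cong)
    fix x show "ennreal (V k (Suc n) x powr 1) = (\<Sum>j\<in>{1..k}. ennreal (c j (x []) * V k n (subtree j x)))"
      using V_nonneg[of k "Suc n" x] V_nonneg c_nonneg by (subst sum_ennreal) auto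
  qed
  also have "\<dots> = (\<Sum>j\<in>{1..k}. \<integral>\<^sup>+x. ennreal (c j (x []) * V k n (subtree j x)) \<partial>tree)"
    by (intro nn_integral_sum measurable_compose[OF _ measurable_ennreal] borel_measurable_times
        measurable_compose[OF subtree_measurable V_measurable]) auto
  also have "\<dots> = (\<Sum>j\<in>{1..k}. (\<integral>\<^sup>+v. ennreal (c j v) \<partial>\<mu>) * (\<integral>\<^sup>+x. ennreal (V k n x) \<partial>tree))"
    using c_nonneg by (intro sum.cong nn_integral_child) auto
  also have "\<dots> = (\<Sum>j\<in>{1..k}. \<integral>\<^sup>+v. ennreal (c j v) \<partial>\<mu>) * (\<integral>\<^sup>+x. ennreal (V k n x) \<partial>tree)"
    by (simp add: sum_distrib_right)
  also have "(\<Sum>j\<in>{1..k}. \<integral>\<^sup>+v. ennreal (c j v) \<partial>\<mu>) = rho_upto 1 k"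
    using c_nonneg by (subst nn_integral_sum[symmetric]) (auto intro!: nn_integral_cong simp: sum_ennreal)
  finally show ?thesis using V_nonneg by simp
qed

end

section \<open>Recursive inequalities for the moments\<close>

text \<open>
  After division by \<open>m ^ n\<close> the increments are bounded by a convergent geometric series.
\<close>

lemma geometric_recursion_bound:
  fixes a :: "nat \<Rightarrow> ennreal" and m r A L :: real
  assumes "0 < m" "0 \<le> r" "r < 1" "0 \<le> A" "0 \<le> L"
    and base: "a 0 \<le> ennreal A"
    and step: "\<And>n. a (Suc n) \<le> ennreal m * a n + ennreal (L * (m ^ n * r ^ n))"
  shows "a n \<le> ennreal ((A + L / (m * (1 - r))) * m ^ n)"
proof -
  have "a n \<le> ennreal (m ^ n * (A + L / m * (\<Sum>l<n. r ^ l)))"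
  proof (induction n)
    case (Suc n)
    have nonneg: "0 \<le> m ^ n * (A + L / m * (\<Sum>l<n. r ^ l))"
      using assms by (intro mult_nonneg_nonneg add_nonneg_nonneg sum_nonneg) auto
    have "a (Suc n) \<le> ennreal m * a n + ennreal (L * (m ^ n * r ^ n))" by (rule step)
    also have "\<dots> \<le> ennreal m * ennreal (m ^ n * (A + L / m * (\<Sum>l<n. r ^ l))) + ennreal (L * (m ^ n * r ^ n))"
      by (intro add_right_mono mult_left_mono Suc.IH) auto
    also have "\<dots> = ennreal (m * (m ^ n * (A + L / m * (\<Sum>l<n. r ^ l))) + L * (m ^ n * r ^ n))"
      using assms nonneg by (simp add: ennreal_mult' ennreal_plus)
    also have "m * (m ^ n * (A + L / m * (\<Sum>l<n. r ^ l))) + L * (m ^ n * r ^ n)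
             = m ^ Suc n * (A + L / m * (\<Sum>l<Suc n. r ^ l))"
      using assms by (simp add: field_simps)
    finally show ?case .
  qed (use base in simp)
  also have "m ^ n * (A + L / m * (\<Sum>l<n. r ^ l)) \<le> (A + L / (m * (1 - r))) * m ^ n"
  proof -
    have "(\<Sum>l<n. r ^ l) = (1 - r ^ n) / (1 - r)" using assms by (simp add: sum_gp_strict)
    also have "\<dots> \<le> 1 / (1 - r)" using assms by (intro divide_right_mono) auto
    finally have "(\<Sum>l<n. r ^ l) \<le> 1 / (1 - r)" .
    then have "L / m * (\<Sum>l<n. r ^ l) \<le> L / m * (1 / (1 - r))"
      by (rule mult_left_mono) (use assms in auto)
    then have "m ^ n * (A + L / m * (\<Sum>l<n. r ^ l)) \<le> m ^ n * (A + L / m * (1 / (1 - r)))"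
      by (rule mult_left_mono[OF add_left_mono]) (use assms in simp)
    then show ?thesis by (simp add: mult.commute)
  qed
  finally show ?thesis by (simp add: ennreal_leI)
qed

context iid_tree
begin

text \<open>
  The inequality \<open>powr_sum_le\<close> for the children of the root, integrated with the help of the branching
  property. The majorant \<open>f\<close> is quantified after the constant, so it may depend on \<open>n\<close>.
\<close>

lemma moment_recursion:
  assumes \<gamma>: "\<gamma> > 0"
  obtains K where "K > 0"
    "\<And>k n f. \<lbrakk>convex_on {0..} f; \<And>u. u \<ge> 0 \<Longrightarrow> u powr \<gamma> \<le> f u; f \<in> borel_measurable borel\<rbrakk> \<Longrightarrow>
       moment (\<gamma> + 1) k (Suc n) \<le> rho_upto (\<gamma> + 1) k * moment (\<gamma> + 1) k n
         + ennreal K * (\<integral>\<^sup>+v. ennreal ((\<Sum>j\<in>{1..k}. c j v) powr (\<gamma> + 1)) \<partial>\<mu>)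
             * (moment 1 k n * (\<integral>\<^sup>+x. ennreal (f (V k n x)) \<partial>tree))"
proof -
  obtain K where K: "K > 0" and ineq:
    "\<And>(I :: nat set) c y f.
       \<lbrakk>finite I; \<And>i. i \<in> I \<Longrightarrow> c i \<ge> 0; \<And>i. i \<in> I \<Longrightarrow> y i \<ge> 0;
        convex_on {0..} f; \<And>u. u \<ge> 0 \<Longrightarrow> u powr \<gamma> \<le> f u\<rbrakk> \<Longrightarrow>
       (\<Sum>i\<in>I. c i * y i) powr (\<gamma> + 1)
         \<le> (\<Sum>i\<in>I. c i powr (\<gamma> + 1) * y i powr (\<gamma> + 1))
           + K * (\<Sum>i\<in>I. \<Sum>j\<in>I - {i}. c i * c j * (\<Sum>l\<in>I - {i}. c l) powr (\<gamma> - 1) * (y i * f (y j)))"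
    using powr_sum_le[OF \<gamma>] by blast
  show thesis
  proof (rule that[OF K])
    fix k n :: nat and f :: "real \<Rightarrow> real"
    assume convex: "convex_on {0..} f" and dom: "\<And>u. u \<ge> 0 \<Longrightarrow> u powr \<gamma> \<le> f u"
      and f [measurable]: "f \<in> borel_measurable borel"
    let ?p = "\<gamma> + 1" and ?I = "{1..k}"
    define w where "w i j v = c i v * c j v * (\<Sum>l\<in>?I - {i}. c l v) powr (\<gamma> - 1)" for i j v
    define y where "y i x = V k n (subtree i x)" for i x
    have w [measurable]: "w i j \<in> borel_measurable \<mu>" for i j unfolding w_def by measurable
    have w0: "w i j v \<ge> 0" for i j v unfolding w_def using c_nonneg by simp
    have y [measurable]: "y i \<in> borel_measurable tree" if "i \<in> ?I" for i
      unfolding y_def using that by (intro measurable_compose[OF subtree_measurable V_measurable]) auto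
    have y0: "y i x \<ge> 0" for i x unfolding y_def by (rule V_nonneg)
    have f0: "f (y i x) \<ge> 0" for i x using order_trans[OF powr_ge_zero dom[OF y0]] .
    have pointwise: "ennreal (V k (Suc n) x powr ?p)
        \<le> (\<Sum>i\<in>?I. ennreal (c i (x []) powr ?p * y i x powr ?p))
          + ennreal K * (\<Sum>i\<in>?I. \<Sum>j\<in>?I - {i}. ennreal (w i j (x []) * (y i x * f (y j x))))" for x
    proof -
      have "V k (Suc n) x powr ?p \<le> (\<Sum>i\<in>?I. c i (x []) powr ?p * y i x powr ?p)
          + K * (\<Sum>i\<in>?I. \<Sum>j\<in>?I - {i}. w i j (x []) * (y i x * f (y j x)))"
        unfolding w_def y_def V.simps
        using ineq[of ?I "\<lambda>i. c i (x [])" "\<lambda>i. V k n (subtree i x)" f] convex dom c_nonneg V_nonneg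
        by simp
      then have "ennreal (V k (Suc n) x powr ?p) \<le> ennreal ((\<Sum>i\<in>?I. c i (x []) powr ?p * y i x powr ?p)
          + K * (\<Sum>i\<in>?I. \<Sum>j\<in>?I - {i}. w i j (x []) * (y i x * f (y j x))))"
        by (rule ennreal_leI)
      also have "\<dots> = ennreal (\<Sum>i\<in>?I. c i (x []) powr ?p * y i x powr ?p)
          + ennreal K * ennreal (\<Sum>i\<in>?I. \<Sum>j\<in>?I - {i}. w i j (x []) * (y i x * f (y j x)))"
        using K w0 y0 f0 by (simp add: ennreal_plus ennreal_mult' sum_nonneg)
      also have "\<dots> = (\<Sum>i\<in>?I. ennreal (c i (x []) powr ?p * y i x powr ?p))
          + ennreal K * (\<Sum>i\<in>?I. \<Sum>j\<in>?I - {i}. ennreal (w i j (x []) * (y i x * f (y j x))))"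
        using w0 y0 f0 by (simp add: sum_ennreal sum_nonneg)
      finally show ?thesis .
    qed
    have diag: "(\<integral>\<^sup>+x. (\<Sum>i\<in>?I. ennreal (c i (x []) powr ?p * y i x powr ?p)) \<partial>tree)
        = rho_upto ?p k * moment ?p k n"
    proof -
      have "(\<integral>\<^sup>+x. (\<Sum>i\<in>?I. ennreal (c i (x []) powr ?p * y i x powr ?p)) \<partial>tree)
          = (\<Sum>i\<in>?I. \<integral>\<^sup>+x. ennreal (c i (x []) powr ?p * y i x powr ?p) \<partial>tree)"
        by (intro nn_integral_sum) auto
      also have "\<dots> = (\<Sum>i\<in>?I. (\<integral>\<^sup>+v. ennreal (c i v powr ?p) \<partial>\<mu>) * moment ?p k n)"
      proof (rule sum.cong[OF refl])
        fix i assume "i \<in> ?I"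
        then show "(\<integral>\<^sup>+x. ennreal (c i (x []) powr ?p * y i x powr ?p) \<partial>tree)
            = (\<integral>\<^sup>+v. ennreal (c i v powr ?p) \<partial>\<mu>) * moment ?p k n"
          unfolding y_def
          using nn_integral_child[of i "\<lambda>v. c i v powr ?p" "\<lambda>x. V k n x powr ?p"] by simp
      qed
      also have "\<dots> = rho_upto ?p k * moment ?p k n"
        by (simp add: sum_distrib_right[symmetric] nn_integral_sum[symmetric] sum_ennreal)
      finally show ?thesis .
    qed
    let ?F = "\<integral>\<^sup>+x. ennreal (f (V k n x)) \<partial>tree"
    have off_diag: "(\<integral>\<^sup>+x. (\<Sum>i\<in>?I. \<Sum>j\<in>?I - {i}. ennreal (w i j (x []) * (y i x * f (y j x)))) \<partial>tree)
        \<le> (\<integral>\<^sup>+v. ennreal ((\<Sum>j\<in>?I. c j v) powr ?p) \<partial>\<mu>) * (moment 1 k n * ?F)"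
    proof -
      have [measurable]: "(\<lambda>x. ennreal (w i j (x []) * (y i x * f (y j x)))) \<in> borel_measurable tree"
        if i: "i \<in> ?I" and "j \<in> ?I - {i}" for i j
      proof -
        have j: "j \<in> ?I" using that by simp
        show ?thesis using i j by measurable
      qed
      have "(\<integral>\<^sup>+x. (\<Sum>i\<in>?I. \<Sum>j\<in>?I - {i}. ennreal (w i j (x []) * (y i x * f (y j x)))) \<partial>tree)
          = (\<Sum>i\<in>?I. \<integral>\<^sup>+x. (\<Sum>j\<in>?I - {i}. ennreal (w i j (x []) * (y i x * f (y j x)))) \<partial>tree)"
        by (intro nn_integral_sum borel_measurable_sum) auto
      also have "\<dots> = (\<Sum>i\<in>?I. \<Sum>j\<in>?I - {i}. \<integral>\<^sup>+x. ennreal (w i j (x []) * (y i x * f (y j x))) \<partial>tree)"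
        by (intro sum.cong refl nn_integral_sum) auto
      also have "\<dots> = (\<Sum>i\<in>?I. \<Sum>j\<in>?I - {i}. (\<integral>\<^sup>+v. ennreal (w i j v) \<partial>\<mu>) * (moment 1 k n * ?F))"
      proof (intro sum.cong refl)
        fix i j assume "i \<in> ?I" "j \<in> ?I - {i}"
        then show "(\<integral>\<^sup>+x. ennreal (w i j (x []) * (y i x * f (y j x))) \<partial>tree)
            = (\<integral>\<^sup>+v. ennreal (w i j v) \<partial>\<mu>) * (moment 1 k n * ?F)"
          unfolding y_def
          using nn_integral_two_children[of i j "w i j" "V k n" "\<lambda>x. f (V k n x)"] w0 V_nonneg by simp
      qed
      also have "\<dots> = (\<Sum>i\<in>?I. \<Sum>j\<in>?I - {i}. \<integral>\<^sup>+v. ennreal (w i j v) \<partial>\<mu>) * (moment 1 k n * ?F)"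
        by (simp only: sum_distrib_right)
      also have "(\<Sum>i\<in>?I. \<Sum>j\<in>?I - {i}. \<integral>\<^sup>+v. ennreal (w i j v) \<partial>\<mu>)
          = (\<integral>\<^sup>+v. (\<Sum>i\<in>?I. \<Sum>j\<in>?I - {i}. ennreal (w i j v)) \<partial>\<mu>)"
        by (simp add: nn_integral_sum)
      also have "\<dots> = (\<integral>\<^sup>+v. ennreal (\<Sum>i\<in>?I. \<Sum>j\<in>?I - {i}. w i j v) \<partial>\<mu>)"
        using w0 by (simp add: sum_ennreal sum_nonneg)
      also have "(\<integral>\<^sup>+v. ennreal (\<Sum>i\<in>?I. \<Sum>j\<in>?I - {i}. w i j v) \<partial>\<mu>) * (moment 1 k n * ?F)
          \<le> (\<integral>\<^sup>+v. ennreal ((\<Sum>j\<in>?I. c j v) powr ?p) \<partial>\<mu>) * (moment 1 k n * ?F)"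
        unfolding w_def using \<gamma> c_nonneg
        by (intro mult_right_mono nn_integral_mono ennreal_leI sum_pair_weights_le) auto
      finally show ?thesis .
    qed
    have [measurable]: "(\<lambda>x. \<Sum>i\<in>?I. \<Sum>j\<in>?I - {i}. ennreal (w i j (x []) * (y i x * f (y j x)))) \<in> borel_measurable tree"
      "(\<lambda>x. \<Sum>i\<in>?I. ennreal (c i (x []) powr ?p * y i x powr ?p)) \<in> borel_measurable tree"
      by (intro borel_measurable_sum; measurable)+
    have "moment ?p k (Suc n)
        \<le> (\<integral>\<^sup>+x. (\<Sum>i\<in>?I. ennreal (c i (x []) powr ?p * y i x powr ?p))
          + ennreal K * (\<Sum>i\<in>?I. \<Sum>j\<in>?I - {i}. ennreal (w i j (x []) * (y i x * f (y j x)))) \<partial>tree)"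
      by (intro nn_integral_mono pointwise)
    also have "\<dots> = rho_upto ?p k * moment ?p k n + ennreal K *
        (\<integral>\<^sup>+x. (\<Sum>i\<in>?I. \<Sum>j\<in>?I - {i}. ennreal (w i j (x []) * (y i x * f (y j x)))) \<partial>tree)"
      using diag by (simp add: nn_integral_add nn_integral_cmult del: sum_ennreal)
    also have "\<dots> \<le> rho_upto ?p k * moment ?p k n
         + ennreal K * ((\<integral>\<^sup>+v. ennreal ((\<Sum>j\<in>{1..k}. c j v) powr ?p) \<partial>\<mu>) * (moment 1 k n * ?F))"
      by (intro add_left_mono mult_left_mono off_diag) auto
    finally show "moment ?p k (Suc n) \<le> rho_upto ?p k * moment ?p k n
         + ennreal K * (\<integral>\<^sup>+v. ennreal ((\<Sum>j\<in>{1..k}. c j v) powr ?p) \<partial>\<mu>) * (moment 1 k n * ?F)"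
      by (simp add: mult.assoc)
  qed
qed

lemma moment_0: "moment p k 0 = (\<integral>\<^sup>+v. ennreal (q v powr p) \<partial>\<mu>)"
  using nn_integral_root[of "\<lambda>v. ennreal (q v powr p)"] by simp

lemma nn_integral_powr_le_one_add:
  assumes "g \<in> borel_measurable \<mu>" "\<And>v. g v \<ge> 0" "0 \<le> p" "p \<le> b" "0 \<le> A"
    and "(\<integral>\<^sup>+v. ennreal (g v powr b) \<partial>\<mu>) \<le> ennreal A"
  shows "(\<integral>\<^sup>+v. ennreal (g v powr p) \<partial>\<mu>) \<le> ennreal (1 + A)"
proof -
  have "(\<integral>\<^sup>+v. ennreal (g v powr p) \<partial>\<mu>) \<le> (\<integral>\<^sup>+v. 1 + ennreal (g v powr b) \<partial>\<mu>)"
  proof (rule nn_integral_mono)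
    fix v
    have "ennreal (g v powr p) \<le> ennreal (1 + g v powr b)"
      using assms by (intro ennreal_leI powr_le_one_add_powr)
    then show "ennreal (g v powr p) \<le> 1 + ennreal (g v powr b)" by (simp add: ennreal_plus)
  qed
  also have "\<dots> = 1 + (\<integral>\<^sup>+v. ennreal (g v powr b) \<partial>\<mu>)"
    using assms by (subst nn_integral_add) (auto simp: emeasure_space_1)
  also have "\<dots> \<le> 1 + ennreal A" using assms by (intro add_left_mono)
  finally show ?thesis using assms by (simp add: ennreal_plus)
qed

lemma rho_upto_interpolation:
  assumes "1 \<le> p" "p \<le> b" "0 \<le> m" "rho_upto 1 k \<le> ennreal m" "rho_upto b k \<le> ennreal m"
  shows "rho_upto p k \<le> ennreal m"
proof -
  obtain t where t: "0 \<le> t" "t \<le> 1"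
    "\<And>x. x \<ge> 0 \<Longrightarrow> x powr p \<le> (1 - t) * x powr 1 + t * x powr b"
    using powr_interpolation[OF assms(1,2)] by blast
  have "rho_upto p k \<le> (\<integral>\<^sup>+v. ennreal (1 - t) * ennreal (\<Sum>j\<in>{1..k}. c j v powr 1)
                             + ennreal t * ennreal (\<Sum>j\<in>{1..k}. c j v powr b) \<partial>\<mu>)"
  proof (rule nn_integral_mono)
    fix v
    have "(\<Sum>j\<in>{1..k}. c j v powr p) \<le> (\<Sum>j\<in>{1..k}. (1 - t) * c j v powr 1 + t * c j v powr b)"
      using c_nonneg by (intro sum_mono t(3))
    also have "\<dots> = (1 - t) * (\<Sum>j\<in>{1..k}. c j v powr 1) + t * (\<Sum>j\<in>{1..k}. c j v powr b)"
      by (simp only: sum.distrib sum_distrib_left)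
    finally have "ennreal (\<Sum>j\<in>{1..k}. c j v powr p) \<le>
      ennreal ((1 - t) * (\<Sum>j\<in>{1..k}. c j v powr 1) + t * (\<Sum>j\<in>{1..k}. c j v powr b))"
      by (rule ennreal_leI)
    also have "\<dots> = ennreal (1 - t) * ennreal (\<Sum>j\<in>{1..k}. c j v powr 1)
                             + ennreal t * ennreal (\<Sum>j\<in>{1..k}. c j v powr b)"
      using t by (subst ennreal_plus) (auto simp: ennreal_mult' intro!: sum_nonneg mult_nonneg_nonneg)
    finally show "ennreal (\<Sum>j\<in>{1..k}. c j v powr p) \<le> \<dots>" .
  qed
  also have "\<dots> = ennreal (1 - t) * rho_upto 1 k + ennreal t * rho_upto b k"
    by (subst nn_integral_add) (auto simp: nn_integral_cmult)
  also have "\<dots> \<le> ennreal (1 - t) * ennreal m + ennreal t * ennreal m"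
    using assms by (intro add_mono mult_left_mono) auto
  also have "\<dots> = ennreal m"
    using t by (simp add: distrib_right[symmetric] ennreal_plus[symmetric] del: ennreal_plus)
  finally show ?thesis .
qed

lemma mean_bound:
  assumes "0 \<le> m" "0 \<le> A" "rho_upto 1 k \<le> ennreal m"
    and "(\<integral>\<^sup>+v. ennreal (q v powr 1) \<partial>\<mu>) \<le> ennreal A"
  shows "moment 1 k n \<le> ennreal (A * m ^ n)"
proof (induction n)
  case 0
  show ?case using assms(4) by (simp only: moment_0) simp
next
  case (Suc n)
  have "moment 1 k (Suc n) \<le> ennreal m * ennreal (A * m ^ n)"
    unfolding mean_Suc using assms Suc by (intro mult_mono) auto
  also have "\<dots> = ennreal (A * m ^ Suc n)"
    using assms by (simp add: ennreal_mult[symmetric] mult_ac)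
  finally show ?case .
qed

section \<open>Geometric decay of the moments\<close>

text \<open>
  Induction on an integer \<open>s\<close>, for all exponents \<open>p\<close> from 1 to \<open>s + 1\<close> simultaneously: exponent \<open>p\<close> is reduced to the
  exponents \<open>p - 1\<close> and 1 if \<open>p \<ge> 2\<close>, and to the first moment alone if \<open>p < 2\<close>. The constant is uniform in the
  truncation \<open>k\<close>.
\<close>

lemma moment_bound_pos:
  fixes b m A B :: real
  assumes b: "1 \<le> b" and m: "0 < m" "m < 1" and nonneg: "0 \<le> A" "0 \<le> B"
    and c1: "\<And>k. rho_upto 1 k \<le> ennreal m" and cb: "\<And>k. rho_upto b k \<le> ennreal m"
    and sum_c: "\<And>k. (\<integral>\<^sup>+v. ennreal ((\<Sum>j\<in>{1..k}. c j v) powr b) \<partial>\<mu>) \<le> ennreal B"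
    and q: "(\<integral>\<^sup>+v. ennreal (q v powr b) \<partial>\<mu>) \<le> ennreal A"
  shows "\<exists>K>0. \<forall>k n. moment b k n \<le> ennreal (K * m ^ n)"
proof -
  have q_p: "(\<integral>\<^sup>+v. ennreal (q v powr p) \<partial>\<mu>) \<le> ennreal (1 + A)" if "1 \<le> p" "p \<le> b" for p
    using that q nonneg q_nonneg by (intro nn_integral_powr_le_one_add[of _ p b]) auto
  have mean: "moment 1 k n \<le> ennreal ((1 + A) * m ^ n)" for k n
    using m nonneg c1 q_p[of 1] b by (intro mean_bound) auto
  have "\<exists>K>0. \<forall>k n. moment p k n \<le> ennreal (K * m ^ n)"
    if "1 \<le> p" "p \<le> b" "p \<le> real s + 1" for p and s :: nat
    using that
  proof (induction s arbitrary: p)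
    case 0
    then have "p = 1" by simp
    then show ?case using mean nonneg by (intro exI[of _ "1 + A"]) auto
  next
    case (Suc s)
    show ?case
    proof (cases "p = 1")
      case True
      then show ?thesis using mean nonneg by (intro exI[of _ "1 + A"]) auto
    next
      case False
      define \<gamma> where "\<gamma> = p - 1"
      have \<gamma>: "\<gamma> > 0" using Suc.prems False by (simp add: \<gamma>_def)
      obtain L where L: "L > 0" and rec:
        "\<And>k n f. \<lbrakk>convex_on {0..} f; \<And>u. u \<ge> 0 \<Longrightarrow> u powr \<gamma> \<le> f u; f \<in> borel_measurable borel\<rbrakk> \<Longrightarrow>
         moment p k (Suc n) \<le> rho_upto p k * moment p k n
         + ennreal L * (\<integral>\<^sup>+v. ennreal ((\<Sum>j\<in>{1..k}. c j v) powr p) \<partial>\<mu>)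
             * (moment 1 k n * (\<integral>\<^sup>+x. ennreal (f (V k n x)) \<partial>tree))"
        using moment_recursion[OF \<gamma>] unfolding \<gamma>_def diff_add_cancel by blast
      have dominating: "\<exists>D r. D \<ge> 0 \<and> 0 \<le> r \<and> r < 1 \<and> (\<forall>n. \<exists>f. convex_on {0..} f \<and>
         (\<forall>u\<ge>0. u powr \<gamma> \<le> f u) \<and> f \<in> borel_measurable borel \<and>
         (\<forall>k. (\<integral>\<^sup>+x. ennreal (f (V k n x)) \<partial>tree) \<le> ennreal (D * r ^ n)))"
      proof (cases "\<gamma> \<ge> 1")
        case True
        then obtain D where "D > 0" "\<forall>k n. moment \<gamma> k n \<le> ennreal (D * m ^ n)"
          using Suc.IH[of \<gamma>] Suc.prems by (auto simp: \<gamma>_def)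
        then show ?thesis
          using m True convex_on_powr_nonneg[of \<gamma>]
          by (intro exI[of _ D] exI[of _ m]) (auto intro!: exI[of _ "\<lambda>u. u powr \<gamma>"])
      next
        case False
        have conc: "\<exists>f. convex_on {0..} f \<and>
         (\<forall>u\<ge>0. u powr \<gamma> \<le> f u) \<and> f \<in> borel_measurable borel \<and>
         (\<forall>k. (\<integral>\<^sup>+x. ennreal (f (V k n x)) \<partial>tree) \<le> ennreal ((2 + A) * (m powr \<gamma>) ^ n))" for n
        proof -
          (* m ^ n bounds the mean up to a constant factor, so with this scale both terms of the
             affine bound are of the order of s powr \<gamma>. *)
          define s where "s = m ^ n"
          have s: "s > 0" using m by (simp add: s_def)
          define f where "f = (\<lambda>u. s powr \<gamma> + s powr (\<gamma> - 1) * u)"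
          have "convex_on {0..} f"
            unfolding f_def by (intro convex_onI) (auto simp: algebra_simps)
          moreover have "u powr \<gamma> \<le> f u" if "u \<ge> 0" for u
            unfolding f_def using \<gamma> False s that by (intro powr_le_affine) auto
          moreover have "f \<in> borel_measurable borel" unfolding f_def by measurable
          moreover have "(\<integral>\<^sup>+x. ennreal (f (V k n x)) \<partial>tree) \<le> ennreal ((2 + A) * (m powr \<gamma>) ^ n)" for k
          proof -
            have "(\<integral>\<^sup>+x. ennreal (f (V k n x)) \<partial>tree)
                = (\<integral>\<^sup>+x. ennreal (s powr \<gamma>) + ennreal (s powr (\<gamma> - 1)) * ennreal (V k n x powr 1) \<partial>tree)"
              using V_nonneg by (simp add: f_def ennreal_plus ennreal_mult)
            also have "\<dots> = ennreal (s powr \<gamma>) + ennreal (s powr (\<gamma> - 1)) * moment 1 k n"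
              by (subst nn_integral_add) (auto simp: nn_integral_cmult T.emeasure_space_1)
            also have "\<dots> \<le> ennreal (s powr \<gamma>) + ennreal (s powr (\<gamma> - 1)) * ennreal ((1 + A) * s)"
              unfolding s_def by (intro add_left_mono mult_left_mono mean) auto
            also have "\<dots> = ennreal (s powr \<gamma> + s powr (\<gamma> - 1) * ((1 + A) * s))"
              using s nonneg by (simp add: ennreal_plus ennreal_mult)
            also have "s powr \<gamma> + s powr (\<gamma> - 1) * ((1 + A) * s) = (2 + A) * s powr \<gamma>"
              using s by (simp add: powr_diff field_simps)
            also have "s powr \<gamma> = (m powr \<gamma>) ^ n"
              using m by (simp add: s_def powr_powr mult.commute flip: powr_realpow)
            finally show ?thesis .
          qed
          ultimately show ?thesis by blast
        qed
        have "m powr \<gamma> < 1" using m \<gamma> powr_less_mono2[of \<gamma> m 1] by simp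
        then show ?thesis using nonneg conc by (intro exI[of _ "2 + A"] exI[of _ "m powr \<gamma>"]) auto
      qed
      then obtain D r where r: "D \<ge> 0" "0 \<le> r" "r < 1" and f: "\<And>n. \<exists>f. convex_on {0..} f \<and>
         (\<forall>u\<ge>0. u powr \<gamma> \<le> f u) \<and> f \<in> borel_measurable borel \<and>
         (\<forall>k. (\<integral>\<^sup>+x. ennreal (f (V k n x)) \<partial>tree) \<le> ennreal (D * r ^ n))"
        by blast
      define L' where "L' = L * (1 + B) * ((1 + A) * D)"
      have L': "L' \<ge> 0" using L nonneg r by (simp add: L'_def)
      have step: "moment p k (Suc n) \<le> ennreal m * moment p k n + ennreal (L' * (m ^ n * r ^ n))" for k n
      proof -
        obtain f where f: "convex_on {0..} f" "\<And>u. u \<ge> 0 \<Longrightarrow> u powr \<gamma> \<le> f u" "f \<in> borel_measurable borel"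
          "(\<integral>\<^sup>+x. ennreal (f (V k n x)) \<partial>tree) \<le> ennreal (D * r ^ n)"
          using f[of n] by blast
        have "(\<integral>\<^sup>+v. ennreal ((\<Sum>j\<in>{1..k}. c j v) powr p) \<partial>\<mu>) \<le> ennreal (1 + B)"
          using Suc.prems sum_c nonneg c_nonneg
          by (intro nn_integral_powr_le_one_add[of _ p b]) (auto intro!: sum_nonneg)
        moreover have "rho_upto p k \<le> ennreal m"
          using Suc.prems c1 cb m by (intro rho_upto_interpolation[of p b]) auto
        ultimately have "moment p k (Suc n) \<le> ennreal m * moment p k n
         + ennreal L * ennreal (1 + B) * (ennreal ((1 + A) * m ^ n) * ennreal (D * r ^ n))"
          using f(4) mean[of k n]
          by (intro order_trans[OF rec[OF f(1-3)]] add_mono mult_mono mult_right_mono) auto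
        also have "ennreal L * ennreal (1 + B) * (ennreal ((1 + A) * m ^ n) * ennreal (D * r ^ n))
           = ennreal (L' * (m ^ n * r ^ n))"
          using L nonneg m r by (simp add: ennreal_mult[symmetric] L'_def mult_ac del: ennreal_plus)
        finally show ?thesis .
      qed
      define K where "K = (1 + A) + L' / (m * (1 - r))"
      have "K > 0" unfolding K_def using nonneg L' m r by (intro add_pos_nonneg divide_nonneg_pos) auto
      moreover have "moment p k n \<le> ennreal (K * m ^ n)" for k n
      proof -
        have base: "moment p k 0 \<le> ennreal (1 + A)"
          unfolding moment_0 using Suc.prems by (intro q_p)
        show ?thesis
          unfolding K_def using m r nonneg L'
          by (intro geometric_recursion_bound[where a = "\<lambda>n. moment p k n" and n = n] base step) simp_all
      qed
      ultimately show ?thesis by blast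
    qed
  qed
  moreover have "b \<le> real (nat \<lceil>b\<rceil>) + 1" using b by linarith
  ultimately show ?thesis using b by blast
qed

text \<open>
  For \<open>m = 0\<close> the recursion cannot be divided by \<open>m\<close>, but then all generations after the
  root have mean 0 and thus vanish almost surely.
\<close>

lemma moment_bound:
  fixes b m A B :: real
  assumes b: "1 \<le> b" and m: "0 \<le> m" "m < 1" and nonneg: "0 \<le> A" "0 \<le> B"
    and c1: "\<And>k. rho_upto 1 k \<le> ennreal m" and cb: "\<And>k. rho_upto b k \<le> ennreal m"
    and sum_c: "\<And>k. (\<integral>\<^sup>+v. ennreal ((\<Sum>j\<in>{1..k}. c j v) powr b) \<partial>\<mu>) \<le> ennreal B"
    and q: "(\<integral>\<^sup>+v. ennreal (q v powr b) \<partial>\<mu>) \<le> ennreal A"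
  shows "\<exists>K>0. \<forall>k n. moment b k n \<le> ennreal (K * m ^ n)"
proof (cases "m = 0")
  case False
  then show ?thesis using assms by (intro moment_bound_pos[of b m A B]) auto
next
  case True
  have "moment b k n \<le> ennreal ((1 + A) * m ^ n)" for k n
  proof (cases n)
    case 0
    have "moment b k 0 \<le> ennreal A" unfolding moment_0 by (rule q)
    also have "\<dots> \<le> ennreal (1 + A)" using nonneg by (intro ennreal_leI) auto
    finally show ?thesis using 0 by simp
  next
    case (Suc l)
    have "(\<integral>\<^sup>+v. ennreal (q v powr 1) \<partial>\<mu>) \<le> ennreal (1 + A)"
      using q nonneg q_nonneg b by (intro nn_integral_powr_le_one_add[of _ 1 b]) auto
    then have "moment 1 k n \<le> ennreal ((1 + A) * m ^ n)"
      using m nonneg c1 by (intro mean_bound) auto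
    also have "\<dots> = 0" using True Suc by simp
    finally have "AE x in tree. V k n x = 0"
      using V_nonneg by (simp add: nn_integral_0_iff_AE)
    then have "AE x in tree. ennreal (V k n x powr b) = 0" by eventually_elim simp
    then have "moment b k n = 0" by (subst nn_integral_0_iff_AE) auto
    then show ?thesis by simp
  qed
  then show ?thesis using nonneg by (intro exI[of _ "1 + A"]) auto
qed

section \<open>Sums over paths\<close>

text \<open>
  The product of the edge weights along a path, read from the root downwards as in the recursion
  for \<open>V\<close>. The lemma \<open>path_weight_snoc\<close> matches it with \<open>weight\<close>, which grows at the last edge.
\<close>

primrec path_weight :: "nat list \<Rightarrow> (nat list \<Rightarrow> 'x) \<Rightarrow> real" where
  "path_weight [] x = 1"
| "path_weight (j # i) x = c j (x []) * path_weight i (subtree j x)"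

lemma path_weight_snoc:
  "i \<in> nodes \<Longrightarrow> path_weight (i @ [j]) x = c j (x i) * path_weight i x"
proof (induction i arbitrary: x)
  case (Cons a i)
  then show ?case by (simp add: subtree_def mult_ac)
qed simp

lemma path_weight_nonneg: "path_weight i x \<ge> 0"
  by (induction i arbitrary: x) (simp_all add: c_nonneg)

lemma V_eq_sum_paths:
  "V k n x = (\<Sum>i | set i \<subseteq> {1..k} \<and> length i = n. q (x i) * path_weight i x)"
proof (induction n arbitrary: x)
  case 0
  have "{i. set i \<subseteq> {1..k} \<and> length i = 0} = {[]}" by auto
  then show ?case by simp
next
  case (Suc n)
  let ?S = "{i. set i \<subseteq> {1..k} \<and> length i = n}"
  have "(\<Sum>i | set i \<subseteq> {1..k} \<and> length i = Suc n. q (x i) * path_weight i x)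
      = (\<Sum>(i, j)\<in>?S \<times> {1..k}. q (x (j # i)) * path_weight (j # i) x)"
    unfolding lists_length_Suc_eq by (subst sum.reindex) (auto simp: inj_on_def case_prod_beta)
  also have "\<dots> = (\<Sum>i\<in>?S. \<Sum>j\<in>{1..k}. q (x (j # i)) * path_weight (j # i) x)"
    by (rule sum.cartesian_product[symmetric])
  also have "\<dots> = (\<Sum>j\<in>{1..k}. \<Sum>i\<in>?S. q (x (j # i)) * path_weight (j # i) x)"
    by (rule sum.swap)
  also have "\<dots> = (\<Sum>j\<in>{1..k}. c j (x []) * V k n (subtree j x))"
    unfolding Suc.IH sum_distrib_left
  proof (intro sum.cong refl)
    fix j i assume "i \<in> ?S"
    then have "i \<in> nodes" by (auto simp: nodes_def)
    then show "q (x (j # i)) * path_weight (j # i) x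
        = c j (x []) * (q (subtree j x i) * path_weight i (subtree j x))"
      by (simp add: subtree_def)
  qed
  finally show ?case by simp
qed

lemma V_mono: "k \<le> l \<Longrightarrow> V k n x \<le> V l n x"
  unfolding V_eq_sum_paths
  by (intro sum_mono2 finite_lists_length_eq mult_nonneg_nonneg q_nonneg path_weight_nonneg) auto

text \<open>
  Finitely many paths use finitely many labels, so that some truncation keeps all of them.
\<close>

lemma sum_paths_le_V:
  assumes "finite F" "F \<subseteq> nodes" "\<And>i. i \<in> F \<Longrightarrow> length i = n"
  obtains k where "(\<Sum>i\<in>F. q (x i) * path_weight i x) \<le> V k n x"
proof -
  have "finite (\<Union>i\<in>F. set i)" using assms by simp
  then obtain k where k: "\<forall>j\<in>(\<Union>i\<in>F. set i). j \<le> k" by (auto simp: finite_nat_set_iff_bounded_le)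
  have "(\<Sum>i\<in>F. q (x i) * path_weight i x) \<le> V k n x"
    unfolding V_eq_sum_paths using assms k
    by (intro sum_mono2 finite_lists_length_eq mult_nonneg_nonneg q_nonneg path_weight_nonneg)
       (fastforce simp: nodes_def)+
  then show thesis by (rule that)
qed

end

lemma (in iid_tree) nn_integral_SUP_V_le:
  assumes "0 \<le> b" "\<And>k. moment b k n \<le> K"
  shows "(\<integral>\<^sup>+x. (SUP k. ennreal (V k n x powr b)) \<partial>tree) \<le> K"
proof -
  have "(\<integral>\<^sup>+x. (SUP k. ennreal (V k n x powr b)) \<partial>tree) = (SUP k. moment b k n)"
    using assms(1) V_mono V_nonneg
    by (intro nn_integral_monotone_convergence_SUP) (auto simp: incseq_def le_fun_def intro!: ennreal_leI powr_mono2)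
  then show ?thesis using assms(2) by (simp add: SUP_le_iff)
qed

section \<open>Transfer to the weighted branching tree\<close>

definition mark_Q :: "real \<times> enat \<times> (nat \<Rightarrow> real) \<Rightarrow> real" where
  "mark_Q v = \<bar>fst v\<bar>"

text \<open>
  Entry \<open>0\<close> of the sequence lies outside of the index set of the product space, where points take the value
  \<open>undefined\<close>; it is replaced by 0.
\<close>

definition mark_C :: "nat \<Rightarrow> real \<times> enat \<times> (nat \<Rightarrow> real) \<Rightarrow> real" where
  "mark_C j v = (if 1 \<le> j then \<bar>snd (snd v) j\<bar> else 0)"

lemma mark_Q_measurable: "mark_Q \<in> borel_measurable mark_space"
  unfolding mark_Q_def mark_space_def by measurable

lemma mark_C_measurable: "mark_C j \<in> borel_measurable mark_space"
proof (cases "1 \<le> j")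
  case True
  have "(\<lambda>v. snd (snd v) j) \<in> borel_measurable mark_space"
    unfolding mark_space_def
    by (rule measurable_compose[OF measurable_compose[OF measurable_snd measurable_snd]
          measurable_component_singleton]) (use True in auto)
  then show ?thesis using True by (simp add: mark_C_def[abs_def])
qed (simp add: mark_C_def[abs_def])

lemma mark_C_nonneg: "mark_C j v \<ge> 0"
  by (simp add: mark_C_def)

lemma mark_Q_mark: "mark_Q (mark Q N C i \<omega>) = \<bar>Q i \<omega>\<bar>"
  by (simp add: mark_Q_def mark_def)

lemma mark_C_mark: "mark_C j (mark Q N C i \<omega>) = (if j \<in> children (N i \<omega>) then \<bar>C (i @ [j]) \<omega>\<bar> else 0)"
  by (auto simp: mark_C_def mark_def children_def)

lemma sum_le_infsum_ennreal:
  fixes f :: "'i \<Rightarrow> ennreal"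
  assumes "finite F" "F \<subseteq> A"
  shows "sum f F \<le> infsum f A"
  using assms by (subst nonneg_infsum_complete) (auto intro: SUP_upper)

lemma sum_mark_C_le_infsum:
  fixes g :: "real \<Rightarrow> real"
  assumes "g 0 = 0" "\<And>u. u \<ge> 0 \<Longrightarrow> g u \<ge> 0"
  shows "ennreal (\<Sum>j\<in>{1..k}. g (mark_C j (mark Q N C [] \<omega>)))
       \<le> (\<Sum>\<^sub>\<infinity>j\<in>children (N [] \<omega>). ennreal (g \<bar>C [j] \<omega>\<bar>))"
proof -
  have "ennreal (\<Sum>j\<in>{1..k}. g (mark_C j (mark Q N C [] \<omega>)))
      = (\<Sum>j\<in>{1..k}. ennreal (g (mark_C j (mark Q N C [] \<omega>))))"
    by (intro sum_ennreal[symmetric] assms(2)) (simp add: mark_C_def)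
  also have "\<dots> = (\<Sum>j\<in>{1..k}. if j \<in> children (N [] \<omega>) then ennreal (g \<bar>C [j] \<omega>\<bar>) else 0)"
    by (intro sum.cong refl) (simp add: mark_C_mark assms(1))
  also have "\<dots> = (\<Sum>j\<in>{1..k} \<inter> children (N [] \<omega>). ennreal (g \<bar>C [j] \<omega>\<bar>))"
    by (simp add: sum.inter_restrict)
  also have "\<dots> \<le> (\<Sum>\<^sub>\<infinity>j\<in>children (N [] \<omega>). ennreal (g \<bar>C [j] \<omega>\<bar>))"
    by (intro sum_le_infsum_ennreal) auto
  finally show ?thesis .
qed

lemma le_ennreal_powr:
  assumes "ennreal s \<le> x" "0 \<le> s" "0 \<le> p"
  shows "ennreal (s powr p) \<le> ennreal_powr x p"
proof (cases x)
  case (real r)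
  then have "s powr p \<le> r powr p" using assms by (intro powr_mono2) auto
  then show ?thesis using real by (simp add: ennreal_powr_def ennreal_leI)
qed (simp add: ennreal_powr_def)

lemma W_le_of_finite_sums_le:
  assumes "\<And>F. finite F \<Longrightarrow> F \<subseteq> generation N n \<omega> \<Longrightarrow> (\<Sum>i\<in>F. \<bar>Q i \<omega> * weight C i \<omega>\<bar>) \<le> R"
  shows "(\<lambda>i. Q i \<omega> * weight C i \<omega>) summable_on generation N n \<omega>" "\<bar>W Q N C n \<omega>\<bar> \<le> R"
proof -
  have abs: "(\<lambda>i. norm (Q i \<omega> * weight C i \<omega>)) summable_on generation N n \<omega>"
    using assms
    by (intro nonneg_bounded_partial_sums_imp_summable_on[where C = R])
       (auto simp: eventually_finite_subsets_at_top intro!: exI[of _ "{}"])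
  then show "(\<lambda>i. Q i \<omega> * weight C i \<omega>) summable_on generation N n \<omega>"
    by (rule abs_summable_summable)
  have "\<bar>W Q N C n \<omega>\<bar> \<le> (\<Sum>\<^sub>\<infinity>i\<in>generation N n \<omega>. \<bar>Q i \<omega> * weight C i \<omega>\<bar>)"
    unfolding W_def using norm_infsum_bound[OF abs] by simp
  also have "\<dots> \<le> R" using abs assms by (intro infsum_le_finite_sums) auto
  finally show "\<bar>W Q N C n \<omega>\<bar> \<le> R" .
qed

definition marks ::
  "(nat list \<Rightarrow> 'a \<Rightarrow> real) \<Rightarrow> (nat list \<Rightarrow> 'a \<Rightarrow> enat) \<Rightarrow> (nat list \<Rightarrow> 'a \<Rightarrow> real)
    \<Rightarrow> 'a \<Rightarrow> nat list \<Rightarrow> real \<times> enat \<times> (nat \<Rightarrow> real)" where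
  "marks Q N C \<omega> = (\<lambda>i\<in>nodes. mark Q N C i \<omega>)"

text \<open>
  The hypotheses of \<open>weighted_branching_tree\<close> in the form of a locale, so that the results for
  the product space can be instantiated with the law of the mark at the root.
\<close>

locale wbt = prob_space M for M :: "'a measure" +
  fixes Q :: "nat list \<Rightarrow> 'a \<Rightarrow> real" and N :: "nat list \<Rightarrow> 'a \<Rightarrow> enat" and C :: "nat list \<Rightarrow> 'a \<Rightarrow> real"
  assumes indep_marks: "indep_vars (\<lambda>_. mark_space) (mark Q N C) nodes"
    and distr_mark: "\<And>i. i \<in> nodes \<Longrightarrow> distr M mark_space (mark Q N C i) = distr M mark_space (mark Q N C [])"
begin

lemma mark_measurable: "i \<in> nodes \<Longrightarrow> mark Q N C i \<in> measurable M mark_space"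
  using indep_marks by (auto simp: indep_vars_def)

lemma iid_tree_mark: "iid_tree (distr M mark_space (mark Q N C [])) mark_Q mark_C"
proof -
  interpret D: prob_space "distr M mark_space (mark Q N C [])"
    by (intro prob_space_distr mark_measurable) simp
  show ?thesis
    by unfold_locales (simp_all add: mark_Q_measurable mark_C_measurable mark_Q_def mark_C_def)
qed

sublocale Tree: iid_tree "distr M mark_space (mark Q N C [])" mark_Q mark_C
  by (rule iid_tree_mark)

lemma sets_tree: "sets Tree.tree = sets (PiM nodes (\<lambda>_. mark_space))"
  unfolding Tree.tree_def by (intro sets_PiM_cong) auto

lemma marks_measurable: "marks Q N C \<in> measurable M Tree.tree"
  unfolding measurable_cong_sets[OF refl sets_tree] marks_def[abs_def]
  by (intro measurable_restrict mark_measurable)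

text \<open>
  This is where the marks being iid enters: independence makes the joint law a product, and equality in
  law makes its factors agree.
\<close>

lemma distr_marks: "distr M Tree.tree (marks Q N C) = Tree.tree"
proof -
  have "nodes \<noteq> {}" using Nil_in_nodes by blast
  have "distr M Tree.tree (marks Q N C) = distr M (PiM nodes (\<lambda>_. mark_space)) (\<lambda>\<omega>. \<lambda>i\<in>nodes. mark Q N C i \<omega>)"
    by (intro distr_cong refl sets_tree) (simp add: marks_def)
  also have "\<dots> = PiM nodes (\<lambda>i. distr M mark_space (mark Q N C i))"
    using indep_marks \<open>nodes \<noteq> {}\<close> mark_measurable by (subst (asm) indep_vars_iff_distr_eq_PiM') auto
  also have "\<dots> = Tree.tree"
    unfolding Tree.tree_def by (intro PiM_cong refl distr_mark)
  finally show ?thesis .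
qed

lemma generation_path_weight:
  "i \<in> generation N n \<omega> \<Longrightarrow>
     i \<in> nodes \<and> length i = n \<and> Tree.path_weight i (marks Q N C \<omega>) = \<bar>weight C i \<omega>\<bar>"
proof (induction n arbitrary: i)
  case (Suc n)
  then obtain i' j where i: "i = i' @ [j]" "i' \<in> generation N n \<omega>" "j \<in> children (N i' \<omega>)" by auto
  then have "i' \<in> nodes" "1 \<le> j" using Suc.IH by (auto simp: children_def)
  then show ?case using i Suc.IH[OF i(2)]
    by (auto simp: nodes_def Tree.path_weight_snoc marks_def mark_C_mark abs_mult)
qed simp

lemma sum_generation_le_V:
  assumes "finite F" "F \<subseteq> generation N n \<omega>"
  obtains k where "(\<Sum>i\<in>F. \<bar>Q i \<omega> * weight C i \<omega>\<bar>) \<le> Tree.V k n (marks Q N C \<omega>)"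
proof -
  have F: "i \<in> nodes" "length i = n" "Tree.path_weight i (marks Q N C \<omega>) = \<bar>weight C i \<omega>\<bar>" if "i \<in> F" for i
    using that assms generation_path_weight by auto
  obtain k where "(\<Sum>i\<in>F. mark_Q (marks Q N C \<omega> i) * Tree.path_weight i (marks Q N C \<omega>)) \<le> Tree.V k n (marks Q N C \<omega>)"
    using Tree.sum_paths_le_V[of F n "marks Q N C \<omega>"] assms F by blast
  also have "(\<Sum>i\<in>F. mark_Q (marks Q N C \<omega> i) * Tree.path_weight i (marks Q N C \<omega>))
      = (\<Sum>i\<in>F. \<bar>Q i \<omega> * weight C i \<omega>\<bar>)"
    using F by (intro sum.cong refl) (simp add: marks_def mark_Q_mark abs_mult)
  finally show thesis by (rule that)
qed

text \<open>
  A bound on all truncated sums bounds all finite partial sums of the series of absolute values, hence gives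
  both its convergence and the estimate.
\<close>

lemma W_powr_le_SUP_V:
  assumes b: "b > 0" and fin: "(SUP k. ennreal (Tree.V k n (marks Q N C \<omega>) powr b)) < \<infinity>"
  shows "(\<lambda>i. Q i \<omega> * weight C i \<omega>) summable_on generation N n \<omega>"
    and "ennreal (\<bar>W Q N C n \<omega>\<bar> powr b) \<le> (SUP k. ennreal (Tree.V k n (marks Q N C \<omega>) powr b))"
proof -
  let ?V = "\<lambda>k. Tree.V k n (marks Q N C \<omega>)"
  obtain u where u: "u \<ge> 0" "(SUP k. ennreal (?V k powr b)) = ennreal u"
    using fin by (cases "SUP k. ennreal (?V k powr b)") auto
  have V_le: "?V k \<le> u powr (1 / b)" for k
  proof -
    have "ennreal (?V k powr b) \<le> ennreal u" unfolding u(2)[symmetric] by (intro SUP_upper) simp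
    then have "?V k powr b \<le> u" using u by simp
    then have "(?V k powr b) powr (1 / b) \<le> u powr (1 / b)" using b by (intro powr_mono2) auto
    then show ?thesis using b Tree.V_nonneg[of k n "marks Q N C \<omega>"] by (simp add: powr_powr)
  qed
  have sums: "(\<Sum>i\<in>F. \<bar>Q i \<omega> * weight C i \<omega>\<bar>) \<le> u powr (1 / b)"
    if "finite F" "F \<subseteq> generation N n \<omega>" for F
    using sum_generation_le_V[OF that] V_le order_trans by metis
  show "(\<lambda>i. Q i \<omega> * weight C i \<omega>) summable_on generation N n \<omega>"
    using sums by (rule W_le_of_finite_sums_le)
  have "\<bar>W Q N C n \<omega>\<bar> \<le> u powr (1 / b)" using sums by (rule W_le_of_finite_sums_le)
  then have "\<bar>W Q N C n \<omega>\<bar> powr b \<le> (u powr (1 / b)) powr b" using b by (intro powr_mono2) auto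
  also have "\<dots> = u" using b u by (simp add: powr_powr)
  finally show "ennreal (\<bar>W Q N C n \<omega>\<bar> powr b) \<le> (SUP k. ennreal (?V k powr b))"
    unfolding u(2) by (rule ennreal_leI)
qed

lemma nn_integral_mark:
  "g \<in> borel_measurable mark_space \<Longrightarrow>
   (\<integral>\<^sup>+v. g v \<partial>distr M mark_space (mark Q N C [])) = (\<integral>\<^sup>+\<omega>. g (mark Q N C [] \<omega>) \<partial>M)"
  by (intro nn_integral_distr mark_measurable) auto

lemma rho_upto_le_rho: "Tree.rho_upto p k \<le> \<rho> M N C p"
proof -
  have [measurable]: "mark_C j \<in> borel_measurable mark_space" for j by (rule mark_C_measurable)
  have "Tree.rho_upto p k = (\<integral>\<^sup>+\<omega>. ennreal (\<Sum>j\<in>{1..k}. mark_C j (mark Q N C [] \<omega>) powr p) \<partial>M)"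
    by (rule nn_integral_mark) measurable
  also have "\<dots> \<le> \<rho> M N C p"
    unfolding \<rho>_def weight_sum_def
    by (intro nn_integral_mono sum_mark_C_le_infsum[where g = "\<lambda>u. u powr p"]) auto
  finally show ?thesis .
qed

lemma sum_c_moment_le:
  assumes "p \<ge> 0"
  shows "(\<integral>\<^sup>+v. ennreal ((\<Sum>j\<in>{1..k}. mark_C j v) powr p) \<partial>distr M mark_space (mark Q N C []))
     \<le> (\<integral>\<^sup>+\<omega>. ennreal_powr (\<Sum>\<^sub>\<infinity>j\<in>children (N [] \<omega>). ennreal \<bar>C [j] \<omega>\<bar>) p \<partial>M)"
proof -
  have [measurable]: "mark_C j \<in> borel_measurable mark_space" for j by (rule mark_C_measurable)
  have "(\<integral>\<^sup>+v. ennreal ((\<Sum>j\<in>{1..k}. mark_C j v) powr p) \<partial>distr M mark_space (mark Q N C []))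
      = (\<integral>\<^sup>+\<omega>. ennreal ((\<Sum>j\<in>{1..k}. mark_C j (mark Q N C [] \<omega>)) powr p) \<partial>M)"
    by (rule nn_integral_mark) measurable
  also have "\<dots> \<le> (\<integral>\<^sup>+\<omega>. ennreal_powr (\<Sum>\<^sub>\<infinity>j\<in>children (N [] \<omega>). ennreal \<bar>C [j] \<omega>\<bar>) p \<partial>M)"
    using assms
    by (intro nn_integral_mono le_ennreal_powr sum_mark_C_le_infsum[where g = "\<lambda>u. u"])
       (auto intro!: sum_nonneg mark_C_nonneg)
  finally show ?thesis .
qed

lemma q_moment: "(\<integral>\<^sup>+v. ennreal (mark_Q v powr p) \<partial>distr M mark_space (mark Q N C []))
     = (\<integral>\<^sup>+\<omega>. ennreal (\<bar>Q [] \<omega>\<bar> powr p) \<partial>M)"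
proof -
  have [measurable]: "mark_Q \<in> borel_measurable mark_space" by (rule mark_Q_measurable)
  show ?thesis by (subst nn_integral_mark) (measurable, simp add: mark_Q_mark)
qed

end

theorem lemma4p4:
  fixes M :: "'a measure"
    and Q :: "nat list \<Rightarrow> 'a \<Rightarrow> real"
    and N :: "nat list \<Rightarrow> 'a \<Rightarrow> enat"
    and C :: "nat list \<Rightarrow> 'a \<Rightarrow> real"
    and \<beta> :: real
  assumes tree: "weighted_branching_tree M Q N C"
    and Q_nonzero: "measure M {\<omega> \<in> space M. Q [] \<omega> \<noteq> 0} > 0"
    and beta: "\<beta> > 1"
    and C_moment: "(\<integral>\<^sup>+ \<omega>. ennreal_powr (\<Sum>\<^sub>\<infinity>j\<in>children (N [] \<omega>). ennreal \<bar>C [j] \<omega>\<bar>) \<beta> \<partial>M) < \<infinity>"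
    and Q_moment: "(\<integral>\<^sup>+ \<omega>. ennreal (\<bar>Q [] \<omega>\<bar> powr \<beta>) \<partial>M) < \<infinity>"
    and rho: "max (\<rho> M N C 1) (\<rho> M N C \<beta>) < 1"
  shows "(\<forall>n. AE \<omega> in M. (\<lambda>i. Q i \<omega> * weight C i \<omega>) summable_on generation N n \<omega>) \<and>
    (\<exists>K::real. K > 0 \<and> (\<forall>n::nat.
      (\<integral>\<^sup>+ \<omega>. ennreal (\<bar>W Q N C n \<omega>\<bar> powr \<beta>) \<partial>M)
        \<le> ennreal K * max (\<rho> M N C 1) (\<rho> M N C \<beta>) ^ n))"
proof -
  interpret wbt M Q N C
    using tree unfolding weighted_branching_tree_def wbt_def wbt_axioms_def by blast
  let ?B = "\<integral>\<^sup>+ \<omega>. ennreal_powr (\<Sum>\<^sub>\<infinity>j\<in>children (N [] \<omega>). ennreal \<bar>C [j] \<omega>\<bar>) \<beta> \<partial>M"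
  let ?A = "\<integral>\<^sup>+ \<omega>. ennreal (\<bar>Q [] \<omega>\<bar> powr \<beta>) \<partial>M"
  define m where "m = enn2real (max (\<rho> M N C 1) (\<rho> M N C \<beta>))"
  have m: "max (\<rho> M N C 1) (\<rho> M N C \<beta>) = ennreal m"
    unfolding m_def using less_trans[OF rho ennreal_one_less_top] by simp
  have "ennreal m < ennreal 1" using rho unfolding m by simp
  then have m01: "0 \<le> m" "m < 1" by (simp_all only: ennreal_less_iff m_def enn2real_nonneg)
  obtain A where A: "0 \<le> A" "?A = ennreal A" using Q_moment by (cases ?A) auto
  obtain B where B: "0 \<le> B" "?B = ennreal B" using C_moment by (cases ?B) auto
  obtain K where K: "K > 0" "\<And>k n. Tree.moment \<beta> k n \<le> ennreal (K * m ^ n)"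
  proof -
    have "\<exists>K>0. \<forall>k n. Tree.moment \<beta> k n \<le> ennreal (K * m ^ n)"
    proof (rule Tree.moment_bound[OF _ m01 A(1) B(1)])
      show "Tree.rho_upto 1 k \<le> ennreal m" for k
        unfolding m[symmetric] by (rule order_trans[OF rho_upto_le_rho max.cobounded1])
      show "Tree.rho_upto \<beta> k \<le> ennreal m" for k
        unfolding m[symmetric] by (rule order_trans[OF rho_upto_le_rho max.cobounded2])
    qed (use beta A B q_moment[of \<beta>] sum_c_moment_le[of \<beta>] in auto)
    then show thesis using that by blast
  qed
  have SUP_bound: "(\<integral>\<^sup>+\<omega>. (SUP k. ennreal (Tree.V k n (marks Q N C \<omega>) powr \<beta>)) \<partial>M) \<le> ennreal (K * m ^ n)" for n
  proof -
    have "(\<integral>\<^sup>+\<omega>. (SUP k. ennreal (Tree.V k n (marks Q N C \<omega>) powr \<beta>)) \<partial>M)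
        = (\<integral>\<^sup>+x. (SUP k. ennreal (Tree.V k n x powr \<beta>)) \<partial>distr M Tree.tree (marks Q N C))"
      by (rule nn_integral_distr[OF marks_measurable, symmetric]) measurable
    also have "\<dots> \<le> ennreal (K * m ^ n)"
      unfolding distr_marks using beta K by (intro Tree.nn_integral_SUP_V_le) auto
    finally show ?thesis .
  qed
  have finite: "AE \<omega> in M. (SUP k. ennreal (Tree.V k n (marks Q N C \<omega>) powr \<beta>)) < \<infinity>" for n
  proof -
    have "(\<lambda>\<omega>. SUP k. ennreal (Tree.V k n (marks Q N C \<omega>) powr \<beta>)) \<in> borel_measurable M"
      by (rule measurable_compose[OF marks_measurable]) measurable
    then have "AE \<omega> in M. (SUP k. ennreal (Tree.V k n (marks Q N C \<omega>) powr \<beta>)) \<noteq> \<infinity>"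
      using le_less_trans[OF SUP_bound[of n] ennreal_less_top] by (intro nn_integral_PInf_AE) auto
    then show ?thesis by (simp add: less_top[symmetric])
  qed
  show ?thesis
  proof (intro conjI allI exI[of _ K])
    fix n
    show "AE \<omega> in M. (\<lambda>i. Q i \<omega> * weight C i \<omega>) summable_on generation N n \<omega>"
      using finite[of n] by eventually_elim (rule W_powr_le_SUP_V, use beta in auto)
    have "(\<integral>\<^sup>+ \<omega>. ennreal (\<bar>W Q N C n \<omega>\<bar> powr \<beta>) \<partial>M)
        \<le> (\<integral>\<^sup>+\<omega>. (SUP k. ennreal (Tree.V k n (marks Q N C \<omega>) powr \<beta>)) \<partial>M)"
      using finite[of n] beta by (intro nn_integral_mono_AE) (auto elim!: eventually_mono intro: W_powr_le_SUP_V)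
    also have "\<dots> \<le> ennreal (K * m ^ n)" by (rule SUP_bound)
    also have "\<dots> = ennreal K * max (\<rho> M N C 1) (\<rho> M N C \<beta>) ^ n"
      using K m01 by (simp add: m ennreal_mult ennreal_power)
    finally show "(\<integral>\<^sup>+ \<omega>. ennreal (\<bar>W Q N C n \<omega>\<bar> powr \<beta>) \<partial>M)
        \<le> ennreal K * max (\<rho> M N C 1) (\<rho> M N C \<beta>) ^ n" .
  qed (rule K)
qed

end
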